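(* Let $\mathcal G$ be the family of all finitely generated non-virtually cyclic groups with a central infinite cyclic subgroup. The family $\mathcal G$ is uniformly unconstricted: for every sequence $(G_n)$ of groups in $\mathcal G$ endowed with word metrics $\mathrm{dist}_n$ (with respect to arbitrary finite generating sets), there exist an ultrafilter $\omega$ and a sequence of scaling constants $d=(d_n)$ with $\lim_\omega d_n=\infty$ such that for every sequence of basepoints $b_n\in G_n$ the ultralimit $\lim^\omega\big(G_n,\frac1{d_n}\mathrm{dist}_n\big)_b$, $b=(b_n)$, is without cut-points.
   Context: Ultrafilters are non-principal, over a countable index set. For metric spaces $(X_n,\mathrm{dist}_n)$ and basepoints $b=(b_n)$, $b_n\in X_n$, the ultralimit $\lim^\omega(X_n)_b$ is the set of sequences $(x_n)$, $x_n\in X_n$, with $\lim_\omega\mathrm{dist}_n(x_n,b_n)<\infty$, with pseudo-distance $\lim_\omega\mathrm{dist}_n(x_n,y_n)$, modulo pseudo-distance $0$. Groups are identified with their Cayley graphs (the resulting ultralimits coincide when $\lim_\omega d_n=\infty$). A (global) cut-point of a space $Y$ is a point whose complement is not path connected; by convention a one-point space has a cut-point. *)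

theory Defs
  imports "HOL-Analysis.Analysis" "HOL-Algebra.Elementary_Groups"
begin

section \<open>Ultrafilters\<close>

definition nonprincipal_ultrafilter :: "'i filter \<Rightarrow> bool" where
  "nonprincipal_ultrafilter \<omega> \<longleftrightarrow>
     \<omega> \<noteq> bot \<and>
     (\<forall>P. eventually P \<omega> \<or> eventually (\<lambda>i. \<not> P i) \<omega>) \<and>
     (\<forall>i. \<omega> \<noteq> principal {i})"

lemma ultrafilter_tendsto_compact:
  fixes f :: "'i \<Rightarrow> 'b::topological_space"
  assumes "nonprincipal_ultrafilter \<omega>" "compact K" "eventually (\<lambda>i. f i \<in> K) \<omega>"
  shows "\<exists>l\<in>K. (f \<longlongrightarrow> l) \<omega>"
proof (rule ccontr)
  assume neg: "\<not> ?thesis"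
  have "\<forall>l\<in>K. \<exists>U. open U \<and> l \<in> U \<and> eventually (\<lambda>i. f i \<notin> U) \<omega>"
    using neg assms(1) unfolding tendsto_def nonprincipal_ultrafilter_def by metis
  then obtain U where U: "\<And>l. l \<in> K \<Longrightarrow> open (U l) \<and> l \<in> U l \<and> eventually (\<lambda>i. f i \<notin> U l) \<omega>"
    by metis
  obtain D where D: "D \<subseteq> K" "finite D" "K \<subseteq> (\<Union>l\<in>D. U l)"
    using compactE_image[OF assms(2), of K U] U by blast
  have "eventually (\<lambda>i. \<forall>l\<in>D. f i \<notin> U l) \<omega>"
    using D U by (intro eventually_ball_finite) auto
  with assms(3) have "eventually (\<lambda>i. False) \<omega>"
    by eventually_elim (use D in blast)
  then show False
    using assms(1) by (simp add: nonprincipal_ultrafilter_def)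
qed

section \<open>Ultralimits of metric spaces\<close>

definition rescale :: "real \<Rightarrow> 'a metric \<Rightarrow> 'a metric" where
  "rescale c m = metric (mspace m, \<lambda>x y. c * mdist m x y)"

lemma Metric_space_rescale:
  assumes "c > 0"
  shows "Metric_space (mspace m) (\<lambda>x y. c * mdist m x y)"
proof -
  interpret Metric_space "mspace m" "mdist m" by blast
  show ?thesis
  proof
    fix x y z assume "x \<in> mspace m" "y \<in> mspace m" "z \<in> mspace m"
    then show "c * mdist m x z \<le> c * mdist m x y + c * mdist m y z"
      using assms triangle[of x y z] by (metis distrib_left mult_le_cancel_left_pos)
  qed (use assms commute in auto)
qed

lemma rescale_simps [simp]:
  assumes "c > 0"
  shows "mspace (rescale c m) = mspace m"
    and "mdist (rescale c m) = (\<lambda>x y. c * mdist m x y)"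
  using Metric_space_rescale[OF assms, of m]
  by (simp_all add: rescale_def Metric_space.mspace_metric Metric_space.mdist_metric)

text \<open>The limit is taken in the extended reals, where it always exists along an ultrafilter.\<close>

definition ulim_seqs :: "'i filter \<Rightarrow> ('i \<Rightarrow> 'a metric) \<Rightarrow> ('i \<Rightarrow> 'a) \<Rightarrow> ('i \<Rightarrow> 'a) set" where
  "ulim_seqs \<omega> X b =
     {x. (\<forall>i. x i \<in> mspace (X i)) \<and> Lim \<omega> (\<lambda>i. ereal (mdist (X i) (x i) (b i))) < \<infinity>}"

definition ulim_pdist :: "'i filter \<Rightarrow> ('i \<Rightarrow> 'a metric) \<Rightarrow> ('i \<Rightarrow> 'a) \<Rightarrow> ('i \<Rightarrow> 'a) \<Rightarrow> real" where
  "ulim_pdist \<omega> X x y = Lim \<omega> (\<lambda>i. mdist (X i) (x i) (y i))"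

definition ulim_rel ::
    "'i filter \<Rightarrow> ('i \<Rightarrow> 'a metric) \<Rightarrow> ('i \<Rightarrow> 'a) \<Rightarrow> (('i \<Rightarrow> 'a) \<times> ('i \<Rightarrow> 'a)) set" where
  "ulim_rel \<omega> X b =
     {(x, y). x \<in> ulim_seqs \<omega> X b \<and> y \<in> ulim_seqs \<omega> X b \<and> ulim_pdist \<omega> X x y = 0}"

definition ulim_space :: "'i filter \<Rightarrow> ('i \<Rightarrow> 'a metric) \<Rightarrow> ('i \<Rightarrow> 'a) \<Rightarrow> ('i \<Rightarrow> 'a) set set" where
  "ulim_space \<omega> X b = ulim_seqs \<omega> X b // ulim_rel \<omega> X b"

text \<open>The value outside the ultralimit is set to 0 because the locale \<open>Metric_space\<close> asks for
  nonnegativity and symmetry on the whole type. Independence of the chosen representatives is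
  \<open>ulim_dist_class\<close> below.\<close>

definition ulim_dist ::
    "'i filter \<Rightarrow> ('i \<Rightarrow> 'a metric) \<Rightarrow> ('i \<Rightarrow> 'a) \<Rightarrow> ('i \<Rightarrow> 'a) set \<Rightarrow> ('i \<Rightarrow> 'a) set \<Rightarrow> real" where
  "ulim_dist \<omega> X b A B =
     (if A \<in> ulim_space \<omega> X b \<and> B \<in> ulim_space \<omega> X b
      then ulim_pdist \<omega> X (SOME x. x \<in> A) (SOME y. y \<in> B) else 0)"

definition ultralimit :: "'i filter \<Rightarrow> ('i \<Rightarrow> 'a metric) \<Rightarrow> ('i \<Rightarrow> 'a) \<Rightarrow> ('i \<Rightarrow> 'a) set metric" where
  "ultralimit \<omega> X b = metric (ulim_space \<omega> X b, ulim_dist \<omega> X b)"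

lemma mdist_triangle:
  "\<lbrakk>x \<in> mspace m; y \<in> mspace m; z \<in> mspace m\<rbrakk> \<Longrightarrow> mdist m x z \<le> mdist m x y + mdist m y z"
  by (rule Metric_space.triangle[OF Metric_space_mspace_mdist])

lemma mdist_sym: "mdist m x y = mdist m y x"
  by (rule Metric_space.commute[OF Metric_space_mspace_mdist])

lemma mdist_ge_0: "0 \<le> mdist m x y"
  by (rule Metric_space.nonneg[OF Metric_space_mspace_mdist])

lemma mdist_refl: "x \<in> mspace m \<Longrightarrow> mdist m x x = 0"
  using Metric_space.zero[OF Metric_space_mspace_mdist, of x m x] by simp

lemma ulim_seqs_iff:
  assumes "nonprincipal_ultrafilter \<omega>"
  shows "x \<in> ulim_seqs \<omega> X b \<longleftrightarrow>
    (\<forall>i. x i \<in> mspace (X i)) \<and> (\<exists>l. ((\<lambda>i. mdist (X i) (x i) (b i)) \<longlongrightarrow> l) \<omega>)"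
proof -
  let ?f = "\<lambda>i. mdist (X i) (x i) (b i)"
  have nb: "\<omega> \<noteq> bot" using assms by (simp add: nonprincipal_ultrafilter_def)
  have ge: "0 \<le> ?f i" for i by (rule mdist_ge_0)
  obtain l where l: "((\<lambda>i. ereal (?f i)) \<longlongrightarrow> l) \<omega>"
    using ultrafilter_tendsto_compact[OF assms compact_UNIV, of "\<lambda>i. ereal (?f i)"] by auto
  have L: "Lim \<omega> (\<lambda>i. ereal (?f i)) = l"
    using tendsto_Lim[OF nb l] .
  have "l \<ge> 0"
    using tendsto_lowerbound[OF l _ nb, of 0] ge by simp
  have "l < \<infinity> \<longleftrightarrow> (\<exists>r. (?f \<longlongrightarrow> r) \<omega>)"
  proof
    assume "l < \<infinity>"
    then obtain r where "l = ereal r" using \<open>l \<ge> 0\<close> by (cases l) auto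
    then show "\<exists>r. (?f \<longlongrightarrow> r) \<omega>" using l by auto
  next
    assume "\<exists>r. (?f \<longlongrightarrow> r) \<omega>"
    then obtain r where "((\<lambda>i. ereal (?f i)) \<longlongrightarrow> ereal r) \<omega>" by auto
    then have "l = ereal r" using tendsto_unique[OF nb l] by blast
    then show "l < \<infinity>" by simp
  qed
  then show ?thesis by (simp add: ulim_seqs_def L)
qed

lemma ulim_pdist_tendsto:
  assumes \<omega>: "nonprincipal_ultrafilter \<omega>" and b: "\<And>i. b i \<in> mspace (X i)"
    and x: "x \<in> ulim_seqs \<omega> X b" and y: "y \<in> ulim_seqs \<omega> X b"
  shows "((\<lambda>i. mdist (X i) (x i) (y i)) \<longlongrightarrow> ulim_pdist \<omega> X x y) \<omega>"
proof -
  have nb: "\<omega> \<noteq> bot" using \<omega> by (simp add: nonprincipal_ultrafilter_def)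
  obtain l where l: "((\<lambda>i. mdist (X i) (x i) (b i)) \<longlongrightarrow> l) \<omega>" and xs: "\<And>i. x i \<in> mspace (X i)"
    using x ulim_seqs_iff[OF \<omega>] by metis
  obtain k where k: "((\<lambda>i. mdist (X i) (y i) (b i)) \<longlongrightarrow> k) \<omega>" and ys: "\<And>i. y i \<in> mspace (X i)"
    using y ulim_seqs_iff[OF \<omega>] by metis
  have "eventually (\<lambda>i. mdist (X i) (x i) (b i) < l + 1) \<omega>"
    using order_tendstoD(2)[OF l] by simp
  moreover have "eventually (\<lambda>i. mdist (X i) (y i) (b i) < k + 1) \<omega>"
    using order_tendstoD(2)[OF k] by simp
  ultimately have "eventually (\<lambda>i. mdist (X i) (x i) (y i) \<in> {0..l + k + 2}) \<omega>"
  proof eventually_elim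
    case (elim i)
    have "mdist (X i) (x i) (y i) \<le> mdist (X i) (x i) (b i) + mdist (X i) (y i) (b i)"
      using mdist_triangle[OF xs b ys, of i] by (simp add: mdist_sym)
    with elim show ?case by (simp add: mdist_ge_0)
  qed
  then obtain r where "((\<lambda>i. mdist (X i) (x i) (y i)) \<longlongrightarrow> r) \<omega>"
    using ultrafilter_tendsto_compact[OF \<omega> compact_Icc, of "\<lambda>i. mdist (X i) (x i) (y i)"] by blast
  then show ?thesis using tendsto_Lim[OF nb, of _ r] by (simp add: ulim_pdist_def)
qed

lemma ulim_pdist_props:
  assumes \<omega>: "nonprincipal_ultrafilter \<omega>" and b: "\<And>i. b i \<in> mspace (X i)"
    and x: "x \<in> ulim_seqs \<omega> X b" and y: "y \<in> ulim_seqs \<omega> X b" and z: "z \<in> ulim_seqs \<omega> X b"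
  shows "0 \<le> ulim_pdist \<omega> X x y" "ulim_pdist \<omega> X x x = 0"
    "ulim_pdist \<omega> X x y = ulim_pdist \<omega> X y x"
    "ulim_pdist \<omega> X x z \<le> ulim_pdist \<omega> X x y + ulim_pdist \<omega> X y z"
proof -
  have nb: "\<omega> \<noteq> bot" using \<omega> by (simp add: nonprincipal_ultrafilter_def)
  have mem: "x i \<in> mspace (X i)" "y i \<in> mspace (X i)" "z i \<in> mspace (X i)" for i
    using x y z by (simp_all add: ulim_seqs_def)
  show "0 \<le> ulim_pdist \<omega> X x y"
    by (rule tendsto_lowerbound[OF ulim_pdist_tendsto[of \<omega> b X, OF \<omega> b x y] _ nb]) (simp add: mdist_ge_0)
  show "ulim_pdist \<omega> X x x = 0"
    using tendsto_Lim[OF nb tendsto_const, of "0::real"]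
    by (simp add: ulim_pdist_def mem mdist_refl)
  show "ulim_pdist \<omega> X x y = ulim_pdist \<omega> X y x"
    by (simp add: ulim_pdist_def mdist_sym)
  show "ulim_pdist \<omega> X x z \<le> ulim_pdist \<omega> X x y + ulim_pdist \<omega> X y z"
    by (rule tendsto_le[OF nb tendsto_add[OF ulim_pdist_tendsto[of \<omega> b X, OF \<omega> b x y]
          ulim_pdist_tendsto[of \<omega> b X, OF \<omega> b y z]] ulim_pdist_tendsto[of \<omega> b X, OF \<omega> b x z]])
       (simp add: mdist_triangle mem)
qed

lemma equiv_ulim_rel:
  assumes \<omega>: "nonprincipal_ultrafilter \<omega>" and b: "\<And>i. b i \<in> mspace (X i)"
  shows "equiv (ulim_seqs \<omega> X b) (ulim_rel \<omega> X b)"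
proof (rule equivI)
  note p = ulim_pdist_props[of \<omega> b X, OF \<omega> b]
  show "ulim_rel \<omega> X b \<subseteq> ulim_seqs \<omega> X b \<times> ulim_seqs \<omega> X b"
    by (auto simp: ulim_rel_def)
  show "refl_on (ulim_seqs \<omega> X b) (ulim_rel \<omega> X b)"
    using p(2) by (auto simp: refl_on_def ulim_rel_def)
  show "sym (ulim_rel \<omega> X b)"
    by (rule symI) (use p(3) in \<open>fastforce simp: ulim_rel_def\<close>)
  show "trans (ulim_rel \<omega> X b)"
  proof (rule transI)
    fix x y z assume "(x, y) \<in> ulim_rel \<omega> X b" "(y, z) \<in> ulim_rel \<omega> X b"
    then show "(x, z) \<in> ulim_rel \<omega> X b"
      using p(4)[of x y z] p(1)[of x z z] by (simp add: ulim_rel_def)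
  qed
qed

lemma ulim_dist_class:
  assumes \<omega>: "nonprincipal_ultrafilter \<omega>" and b: "\<And>i. b i \<in> mspace (X i)"
    and A: "A \<in> ulim_space \<omega> X b" "x \<in> A" and B: "B \<in> ulim_space \<omega> X b" "y \<in> B"
  shows "ulim_dist \<omega> X b A B = ulim_pdist \<omega> X x y"
proof -
  note p = ulim_pdist_props[of \<omega> b X, OF \<omega> b]
  note e = equiv_ulim_rel[of \<omega> b X, OF \<omega> b]
  define x' y' where "x' = (SOME x. x \<in> A)" and "y' = (SOME y. y \<in> B)"
  have "x' \<in> A" "y' \<in> B"
    unfolding x'_def y'_def using A(2) B(2) by (metis someI)+
  then have r: "(x, x') \<in> ulim_rel \<omega> X b" "(y, y') \<in> ulim_rel \<omega> X b"
    using A B quotient_eq_iff[OF e] unfolding ulim_space_def by blast+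
  then have s: "x \<in> ulim_seqs \<omega> X b" "x' \<in> ulim_seqs \<omega> X b" "y \<in> ulim_seqs \<omega> X b" "y' \<in> ulim_seqs \<omega> X b"
    and z: "ulim_pdist \<omega> X x x' = 0" "ulim_pdist \<omega> X y y' = 0"
    by (simp_all add: ulim_rel_def)
  have "ulim_pdist \<omega> X x' y' \<le> ulim_pdist \<omega> X x y"
    using p(4)[OF s(2,1,4)] p(4)[OF s(1,3,4)] p(3)[OF s(1,2) s(1)] z by linarith
  moreover have "ulim_pdist \<omega> X x y \<le> ulim_pdist \<omega> X x' y'"
    using p(4)[OF s(1,2,3)] p(4)[OF s(2,4,3)] p(3)[OF s(3,4) s(1)] z by linarith
  ultimately show ?thesis
    using A B by (simp add: ulim_dist_def x'_def y'_def)
qed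

lemma Metric_space_ultralimit:
  assumes \<omega>: "nonprincipal_ultrafilter \<omega>" and b: "\<And>i. b i \<in> mspace (X i)"
  shows "Metric_space (ulim_space \<omega> X b) (ulim_dist \<omega> X b)"
proof -
  let ?M = "ulim_space \<omega> X b" and ?d = "ulim_dist \<omega> X b"
  note p = ulim_pdist_props[of \<omega> b X, OF \<omega> b]
  note e = equiv_ulim_rel[of \<omega> b X, OF \<omega> b]
  note c = ulim_dist_class[of \<omega> b X, OF \<omega> b]
  have rep: "\<exists>x. x \<in> A \<and> x \<in> ulim_seqs \<omega> X b" if "A \<in> ?M" for A
    using that in_quotient_imp_non_empty[OF e] in_quotient_imp_subset[OF e]
    unfolding ulim_space_def by blast
  have ge: "0 \<le> ?d A B \<and> ?d A B = ?d B A" for A B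
  proof (cases "A \<in> ?M \<and> B \<in> ?M")
    case True
    then obtain x y where "x \<in> A" "y \<in> B" "x \<in> ulim_seqs \<omega> X b" "y \<in> ulim_seqs \<omega> X b"
      using rep by meson
    then show ?thesis using True c[of A x B y] c[of B y A x] p(1)[of x y y] p(3)[of x y y] by simp
  qed (auto simp: ulim_dist_def)
  show ?thesis
  proof
    show "0 \<le> ?d A B" for A B using ge by blast
    show "?d A B = ?d B A" for A B using ge by blast
    show "?d A B = 0 \<longleftrightarrow> A = B" if AB: "A \<in> ?M" "B \<in> ?M" for A B
    proof -
      obtain x y where xy: "x \<in> A" "y \<in> B" "x \<in> ulim_seqs \<omega> X b" "y \<in> ulim_seqs \<omega> X b"
        using AB rep by meson
      have "?d A B = 0 \<longleftrightarrow> (x, y) \<in> ulim_rel \<omega> X b"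
        using c[OF AB(1) xy(1) AB(2) xy(2)] xy by (simp add: ulim_rel_def)
      also have "\<dots> \<longleftrightarrow> A = B"
        using quotient_eq_iff[OF e] AB xy unfolding ulim_space_def by blast
      finally show ?thesis .
    qed
    show "?d A C \<le> ?d A B + ?d B C" if ABC: "A \<in> ?M" "B \<in> ?M" "C \<in> ?M" for A B C
    proof -
      obtain x y z where xyz: "x \<in> A" "y \<in> B" "z \<in> C"
        "x \<in> ulim_seqs \<omega> X b" "y \<in> ulim_seqs \<omega> X b" "z \<in> ulim_seqs \<omega> X b"
        using ABC rep by meson
      then show ?thesis
        using ABC c[of A x C z] c[of A x B y] c[of B y C z] p(4)[of x y z] by simp
    qed
  qed
qed

lemma ultralimit_simps [simp]:
  assumes "nonprincipal_ultrafilter \<omega>" "\<And>i. b i \<in> mspace (X i)"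
  shows "mspace (ultralimit \<omega> X b) = ulim_space \<omega> X b"
    and "mdist (ultralimit \<omega> X b) = ulim_dist \<omega> X b"
  using Metric_space_ultralimit[of \<omega> b X, OF assms]
  by (simp_all add: ultralimit_def Metric_space.mspace_metric Metric_space.mdist_metric)

section \<open>Cut-points and uniformly unconstricted families\<close>

text \<open>The first disjunct is the convention for one-point spaces; without it the empty complement
  would count as path connected.\<close>

definition cut_point :: "'a topology \<Rightarrow> 'a \<Rightarrow> bool" where
  "cut_point T p \<longleftrightarrow> p \<in> topspace T \<and>
     (topspace T = {p} \<or> \<not> path_connected_space (subtopology T (topspace T - {p})))"

definition uniformly_unconstricted :: "'a metric set \<Rightarrow> bool" where
  "uniformly_unconstricted \<X> \<longleftrightarrow>
     (\<forall>X :: nat \<Rightarrow> 'a metric. (\<forall>n. X n \<in> \<X>) \<longrightarrow>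
        (\<exists>(\<omega> :: nat filter) (d :: nat \<Rightarrow> real).
           nonprincipal_ultrafilter \<omega> \<and> (\<forall>n. 0 < d n) \<and> filterlim d at_top \<omega> \<and>
           (\<forall>b. (\<forall>n. b n \<in> mspace (X n)) \<longrightarrow>
              (\<nexists>p. cut_point (mtopology_of (ultralimit \<omega> (\<lambda>n. rescale (1 / d n) (X n)) b)) p))))"

section \<open>Groups and word metrics\<close>

definition finite_generating_set :: "('a, 'm) monoid_scheme \<Rightarrow> 'a set \<Rightarrow> bool" where
  "finite_generating_set G S \<longleftrightarrow> finite S \<and> S \<subseteq> carrier G \<and> generate G S = carrier G"

definition virtually_cyclic :: "('a, 'm) monoid_scheme \<Rightarrow> bool" where
  "virtually_cyclic G \<longleftrightarrow>
     (\<exists>H. subgroup H G \<and> cyclic_group (G\<lparr>carrier := H\<rparr>) \<and> finite (rcosets\<^bsub>G\<^esub> H))"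

definition central_infinite_cyclic :: "'a set \<Rightarrow> ('a, 'm) monoid_scheme \<Rightarrow> bool" where
  "central_infinite_cyclic Z G \<longleftrightarrow>
     subgroup Z G \<and> cyclic_group (G\<lparr>carrier := Z\<rparr>) \<and> infinite Z \<and>
     (\<forall>z\<in>Z. \<forall>g\<in>carrier G. z \<otimes>\<^bsub>G\<^esub> g = g \<otimes>\<^bsub>G\<^esub> z)"

definition family_G :: "'a monoid set" where
  "family_G = {G. group G \<and> (\<exists>S. finite_generating_set G S) \<and> \<not> virtually_cyclic G \<and>
                  (\<exists>Z. central_infinite_cyclic Z G)}"

definition word_prod :: "('a, 'm) monoid_scheme \<Rightarrow> 'a list \<Rightarrow> 'a" where
  "word_prod G ws = foldr (\<lambda>x y. x \<otimes>\<^bsub>G\<^esub> y) ws \<one>\<^bsub>G\<^esub>"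

definition word_length :: "('a, 'm) monoid_scheme \<Rightarrow> 'a set \<Rightarrow> 'a \<Rightarrow> nat" where
  "word_length G S g =
     (LEAST n. \<exists>ws. length ws = n \<and> set ws \<subseteq> S \<union> m_inv G ` S \<and> word_prod G ws = g)"

text \<open>As for \<open>ulim_dist\<close>, the value outside the carrier is set to 0 for \<open>Metric_space\<close>.\<close>

definition word_dist :: "('a, 'm) monoid_scheme \<Rightarrow> 'a set \<Rightarrow> 'a \<Rightarrow> 'a \<Rightarrow> real" where
  "word_dist G S g h =
     (if g \<in> carrier G \<and> h \<in> carrier G then real (word_length G S (inv\<^bsub>G\<^esub> g \<otimes>\<^bsub>G\<^esub> h)) else 0)"

definition word_metric :: "('a, 'm) monoid_scheme \<Rightarrow> 'a set \<Rightarrow> 'a metric" where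
  "word_metric G S = metric (carrier G, word_dist G S)"

lemma (in group) word_prod_closed: "set ws \<subseteq> carrier G \<Longrightarrow> word_prod G ws \<in> carrier G"
  by (induction ws) (auto simp: word_prod_def)

lemma (in group) word_prod_append:
  "\<lbrakk>set us \<subseteq> carrier G; set vs \<subseteq> carrier G\<rbrakk> \<Longrightarrow>
    word_prod G (us @ vs) = word_prod G us \<otimes> word_prod G vs"
proof (induction us)
  case Nil
  then show ?case using word_prod_closed[of vs] by (simp add: word_prod_def)
next
  case (Cons u us)
  have "word_prod G ((u # us) @ vs) = u \<otimes> word_prod G (us @ vs)"
    by (simp add: word_prod_def)
  also have "\<dots> = (u \<otimes> word_prod G us) \<otimes> word_prod G vs"
    using Cons word_prod_closed by (simp add: m_assoc)
  finally show ?case by (simp add: word_prod_def)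
qed

lemma (in group) word_prod_inv:
  "set ws \<subseteq> carrier G \<Longrightarrow> word_prod G (rev (map (m_inv G) ws)) = inv (word_prod G ws)"
proof (induction ws)
  case Nil
  then show ?case by (simp add: word_prod_def)
next
  case (Cons w ws)
  have "word_prod G (rev (map (m_inv G) (w # ws))) = inv (word_prod G ws) \<otimes> word_prod G [inv w]"
    using Cons word_prod_append[of "rev (map (m_inv G) ws)" "[inv w]"] by auto
  also have "\<dots> = inv (w \<otimes> word_prod G ws)"
    using Cons word_prod_closed[of ws] by (simp add: word_prod_def inv_mult_group)
  finally show ?case by (simp add: word_prod_def)
qed

lemma (in group) word_exists:
  assumes "S \<subseteq> carrier G" "g \<in> generate G S"
  shows "\<exists>ws. set ws \<subseteq> S \<union> m_inv G ` S \<and> word_prod G ws = g"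
  using assms(2)
proof induction
  case one
  then show ?case by (intro exI[of _ "[]"]) (simp add: word_prod_def)
next
  case (incl h)
  then show ?case using assms(1) by (intro exI[of _ "[h]"]) (auto simp: word_prod_def)
next
  case (inv h)
  then show ?case using assms(1) by (intro exI[of _ "[inv h]"]) (auto simp: word_prod_def)
next
  case (eng h1 h2)
  then obtain us vs where *: "set us \<subseteq> S \<union> m_inv G ` S" "word_prod G us = h1"
    "set vs \<subseteq> S \<union> m_inv G ` S" "word_prod G vs = h2" by auto
  have "S \<union> m_inv G ` S \<subseteq> carrier G" using assms(1) by auto
  with * have "word_prod G (us @ vs) = h1 \<otimes> h2"
    using word_prod_append[of us vs] by auto
  with * show ?case by (intro exI[of _ "us @ vs"]) auto
qed

lemma (in group) Metric_space_word_dist: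
  assumes "finite_generating_set G S"
  shows "Metric_space (carrier G) (word_dist G S)"
proof -
  let ?A = "S \<union> m_inv G ` S"
  have S: "S \<subseteq> carrier G" "generate G S = carrier G" and A: "?A \<subseteq> carrier G"
    using assms by (auto simp: finite_generating_set_def)
  have ex: "\<exists>ws. length ws = word_length G S g \<and> set ws \<subseteq> ?A \<and> word_prod G ws = g"
    if g: "g \<in> carrier G" for g
  proof -
    obtain ws where "set ws \<subseteq> ?A \<and> word_prod G ws = g" using word_exists[OF S(1)] S(2) g by auto
    then show ?thesis
      using LeastI[of "\<lambda>n. \<exists>ws. length ws = n \<and> set ws \<subseteq> ?A \<and> word_prod G ws = g" "length ws"]
      unfolding word_length_def by blast
  qed
  have le: "word_length G S (word_prod G ws) \<le> length ws" if "set ws \<subseteq> ?A" for ws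
    unfolding word_length_def using that by (intro Least_le) auto
  have inv_le: "word_length G S (inv g) \<le> word_length G S g" if g: "g \<in> carrier G" for g
  proof -
    obtain ws where ws: "length ws = word_length G S g" "set ws \<subseteq> ?A" "word_prod G ws = g"
      using ex[OF g] by blast
    have "m_inv G ` ?A \<subseteq> ?A"
      using S(1) by (auto simp: image_Un image_image subset_iff)
    then have "set (rev (map (m_inv G) ws)) \<subseteq> ?A"
      using ws(2) by (simp only: set_rev set_map) (meson image_mono subset_trans)
    then show ?thesis
      using le[of "rev (map (m_inv G) ws)"] ws A word_prod_inv[of ws] by auto
  qed
  have mult_le: "word_length G S (g \<otimes> h) \<le> word_length G S g + word_length G S h"
    if gh: "g \<in> carrier G" "h \<in> carrier G" for g h
  proof -
    obtain us vs where uv: "length us = word_length G S g" "set us \<subseteq> ?A" "word_prod G us = g"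
      "length vs = word_length G S h" "set vs \<subseteq> ?A" "word_prod G vs = h"
      using ex gh by metis
    have "word_prod G (us @ vs) = g \<otimes> h" using word_prod_append[of us vs] uv A by auto
    then show ?thesis using le[of "us @ vs"] uv by simp
  qed
  have zero: "word_length G S g = 0 \<longleftrightarrow> g = \<one>" if g: "g \<in> carrier G" for g
    using ex[OF g] le[of "[]"] by (auto simp: word_prod_def)
  show ?thesis
  proof
    show "0 \<le> word_dist G S g h" for g h by (simp add: word_dist_def)
    show "word_dist G S g h = word_dist G S h g" for g h
    proof (cases "g \<in> carrier G \<and> h \<in> carrier G")
      case True
      then have "inv (inv g \<otimes> h) = inv h \<otimes> g" "inv (inv h \<otimes> g) = inv g \<otimes> h"
        by (simp_all add: inv_mult_group)
      then show ?thesis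
        using True inv_le[of "inv g \<otimes> h"] inv_le[of "inv h \<otimes> g"] by (simp add: word_dist_def)
    qed (auto simp: word_dist_def)
    show "word_dist G S g h = 0 \<longleftrightarrow> g = h" if "g \<in> carrier G" "h \<in> carrier G" for g h
    proof -
      have "inv g \<otimes> h = \<one> \<longleftrightarrow> g = h"
        using that by (metis inv_closed inv_equality inv_inv l_inv)
      then show ?thesis using that zero[of "inv g \<otimes> h"] by (simp add: word_dist_def)
    qed
    show "word_dist G S g k \<le> word_dist G S g h + word_dist G S h k"
      if "g \<in> carrier G" "h \<in> carrier G" "k \<in> carrier G" for g h k
    proof -
      have "(inv g \<otimes> h) \<otimes> (inv h \<otimes> k) = inv g \<otimes> k"
        using that by (metis inv_closed inv_solve_left m_assoc m_closed)
      then show ?thesis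
        using that mult_le[of "inv g \<otimes> h" "inv h \<otimes> k"] by (simp add: word_dist_def)
    qed
  qed
qed

lemma (in group) word_metric_simps:
  assumes "finite_generating_set G S"
  shows "mspace (word_metric G S) = carrier G"
    and "mdist (word_metric G S) = word_dist G S"
  using Metric_space_word_dist[OF assms]
  by (simp_all add: word_metric_def Metric_space.mspace_metric Metric_space.mdist_metric)

end

theory Submission
  imports Defs
begin

text \<open>
  Let \<open>Z\<close> be a central infinite cyclic subgroup of \<open>G\<close>. Right multiplication by \<open>z \<in> Z\<close> is an
  isometry of the word metric that moves every point by the same distance, the length of \<open>z\<close>.
  If the scaling constants are large compared with the length of a generator of \<open>Z\<close>, then the lengths
  of elements of \<open>Z\<close> form a dense set after scaling (\<open>cyclic_subgroup_lengths\<close>), so the ultralimit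
  has translations of every length \<open>\<epsilon> > 0\<close>. It is a geodesic space (\<open>geodesic_ultralimit\<close>).

  Since \<open>G\<close> is not virtually cyclic, \<open>Z\<close> has infinite index, and at every scale \<open>r\<close> there is an
  element of length \<open>r\<close> for which the identity is a nearest point of \<open>Z\<close>
  (\<open>far_from_infinite_index_subgroup\<close>). In the ultralimit, every point \<open>p\<close> therefore has a
  point \<open>y\<close> at distance \<open>1\<close> such that \<open>p\<close> is a nearest point to \<open>y\<close> of its own orbit under the
  translations.

  This prevents \<open>p\<close> from being a cut-point. Let \<open>v \<noteq> p\<close>, and let \<open>z\<close> be a translation by less than
  \<open>d(v,p)\<close>. Either a geodesic from \<open>v\<close> to \<open>p\<close> meets \<open>pz\<close>, or its translate by the inverse of \<open>z\<close>
  avoids \<open>p\<close>. In the first case \<open>v\<close> is joined to \<open>pz\<close>, in the second to the translate of \<open>p\<close> by the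
  inverse of \<open>z\<close>, without meeting \<open>p\<close> (\<open>joined_off_translate\<close>). If \<open>z\<close> is a translation by less
  than \<open>1\<close>, then \<open>y\<close> is joined to both, as the geodesic from \<open>y\<close> to \<open>p\<close> cannot meet a translate of
  \<open>p\<close>, which would be closer to \<open>y\<close>. So \<open>v\<close> is joined to \<open>y\<close>, and the complement of \<open>p\<close> is path
  connected (\<open>no_cut_point_if_translations\<close>).

  No step depends on the base points or on the choice of the non-principal ultrafilter, so one
  sequence of scales, chosen in advance, serves all of them.
\<close>

section \<open>A non-principal ultrafilter on the natural numbers\<close>

text \<open>The ultrafilter is a minimal proper filter below \<^term>\<open>sequentially\<close>, which
  Zorn's lemma provides. Staying below \<^term>\<open>sequentially\<close> makes it non-principal, and it also
  lets limits along the natural numbers pass to it.\<close>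

lemma exists_nonprincipal_ultrafilter:
  "\<exists>\<omega> :: nat filter. nonprincipal_ultrafilter \<omega> \<and> \<omega> \<le> sequentially"
proof -
  let ?A = "{F :: nat filter. F \<noteq> bot \<and> F \<le> sequentially}"
  have "\<exists>m\<in>?A. \<forall>a\<in>?A. a \<le> m \<longrightarrow> a = m"
  proof (rule predicate_Zorn)
    show "partial_order_on ?A (relation_of (\<lambda>x y. y \<le> x) ?A)"
      by (rule partial_order_on_relation_ofI) auto
    fix C assume C: "C \<in> Chains (relation_of (\<lambda>x y. y \<le> x) ?A)"
    then have CA: "C \<subseteq> ?A" and tot: "\<And>F G. F \<in> C \<Longrightarrow> G \<in> C \<Longrightarrow> F \<le> G \<or> G \<le> F"
      by (auto simp: Chains_def relation_of_def)
    show "\<exists>u\<in>?A. \<forall>a\<in>C. u \<le> a"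
    proof (cases "C = {}")
      case True
      then show ?thesis by (intro bexI[of _ sequentially]) auto
    next
      case False
      \<comment> \<open>The infimum of a chain is proper because the chain is directed: an event of the infimum is already an event of a member.\<close>
      have "\<exists>x\<in>C. x \<le> inf F G" if "F \<in> C" "G \<in> C" for F G
        using tot[OF that] that by (metis le_inf_iff order_refl)
      then have "eventually (\<lambda>_. False) (Inf C) \<longleftrightarrow> (\<exists>F\<in>C. eventually (\<lambda>_. False) F)"
        using False by (intro eventually_Inf_base) auto
      then have "Inf C \<noteq> bot"
        using CA unfolding trivial_limit_def by blast
      moreover obtain F where "F \<in> C" "F \<le> sequentially"
        using False CA by auto
      then have "Inf C \<le> sequentially" by (rule Inf_lower2)
      ultimately show ?thesis by (intro bexI[of _ "Inf C"]) (auto intro: Inf_lower)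
    qed
  qed
  then obtain \<omega> :: "nat filter" where \<omega>: "\<omega> \<noteq> bot" "\<omega> \<le> sequentially"
    and min: "\<And>F. F \<noteq> bot \<Longrightarrow> F \<le> \<omega> \<Longrightarrow> F = \<omega>"
    by (fastforce intro: order_trans)
  have "eventually P \<omega> \<or> eventually (\<lambda>i. \<not> P i) \<omega>" for P
  proof (rule disjCI)
    assume "\<not> eventually (\<lambda>i. \<not> P i) \<omega>"
    then have "inf \<omega> (principal {i. P i}) \<noteq> bot"
      by (simp add: trivial_limit_def eventually_inf_principal)
    then have "\<omega> \<le> principal {i. P i}" 
      using min[of "inf \<omega> (principal {i. P i})"] by (metis (no_types) inf.cobounded1 inf.cobounded2)
    \<comment> \<open>By minimality, restricting the filter to the set where P holds changes nothing.\<close>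
    then show "eventually P \<omega>" by (simp add: le_principal)
  qed
  moreover have "\<omega> \<noteq> principal {i}" for i
  proof
    assume "\<omega> = principal {i}"
    then show False
      using filter_leD[OF \<omega>(2) eventually_gt_at_top[of i]] by (simp add: eventually_principal)
  qed
  ultimately show ?thesis using \<omega> by (auto simp: nonprincipal_ultrafilter_def)
qed

section \<open>Geodesic spaces and points that do not separate\<close>

definition geodesic_space :: "'a metric \<Rightarrow> bool" where
  "geodesic_space m \<longleftrightarrow>
     (\<forall>x\<in>mspace m. \<forall>y\<in>mspace m. \<exists>\<gamma>::real \<Rightarrow> 'a.
        \<gamma> 0 = x \<and> \<gamma> 1 = y \<and> (\<forall>t\<in>{0..1}. \<gamma> t \<in> mspace m) \<and>
        (\<forall>s\<in>{0..1}. \<forall>t\<in>{0..1}. mdist m (\<gamma> s) (\<gamma> t) = \<bar>s - t\<bar> * mdist m x y))"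

lemma geodesicE:
  assumes "geodesic_space m" "x \<in> mspace m" "y \<in> mspace m"
  obtains \<gamma> :: "real \<Rightarrow> 'a" where "\<gamma> 0 = x" "\<gamma> 1 = y" "\<And>t. t \<in> {0..1} \<Longrightarrow> \<gamma> t \<in> mspace m"
    "\<And>s t. s \<in> {0..1} \<Longrightarrow> t \<in> {0..1} \<Longrightarrow> mdist m (\<gamma> s) (\<gamma> t) = \<bar>s - t\<bar> * mdist m x y"
  using assms unfolding geodesic_space_def by blast

text \<open>Lying in one path component of the complement of \<open>p\<close>. A point that lies outside the space or
  equals \<open>p\<close> is joined to nothing.\<close>

definition joined_off :: "'a metric \<Rightarrow> 'a \<Rightarrow> 'a \<Rightarrow> 'a \<Rightarrow> bool" where
  "joined_off m p = path_component_of (subtopology (mtopology_of m) (mspace m - {p}))"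

lemma joined_off_sym: "joined_off m p x y \<Longrightarrow> joined_off m p y x"
  by (simp add: joined_off_def path_component_of_sym_iff)

lemma joined_off_trans: "joined_off m p x y \<Longrightarrow> joined_off m p y z \<Longrightarrow> joined_off m p x z"
  unfolding joined_off_def by (rule path_component_of_trans)

lemma Lipschitz_curve_joined_off:
  assumes \<gamma>: "\<And>t. t \<in> {0..1} \<Longrightarrow> \<gamma> t \<in> mspace m - {p}"
    and lip: "\<And>s t. s \<in> {0..1} \<Longrightarrow> t \<in> {0..1} \<Longrightarrow> mdist m (\<gamma> s) (\<gamma> t) \<le> B * \<bar>s - t\<bar>"
  shows "joined_off m p (\<gamma> 0) (\<gamma> (1::real))"
proof -
  have "Lipschitz_continuous_map (submetric euclidean_metric {0..1}) m \<gamma>"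
    unfolding Lipschitz_continuous_map_def
  proof (intro conjI exI ballI)
    show "\<gamma> \<in> mspace (submetric euclidean_metric {0..1}) \<rightarrow> mspace m" using \<gamma> by auto
    fix s t assume "s \<in> mspace (submetric euclidean_metric {0..1::real})"
      "t \<in> mspace (submetric euclidean_metric {0..1::real})"
    then show "mdist m (\<gamma> s) (\<gamma> t) \<le> B * mdist (submetric euclidean_metric {0..1}) s t"
      using lip[of s t] by (simp add: dist_real_def)
  qed
  then have "pathin (mtopology_of m) \<gamma>"
    unfolding pathin_def by (metis Lipschitz_continuous_imp_continuous_map
        mtopology_of_euclidean mtopology_of_submetric)
  then show ?thesis
    unfolding joined_off_def path_component_of_def
    using \<gamma> by (intro exI[of _ \<gamma>]) (auto simp: pathin_subtopology)
qed

text \<open>All points of a geodesic from \<open>x\<close> to \<open>y\<close> are at distance at most \<open>d(x,y)\<close> from \<open>x\<close>, so it cannot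
  reach a point \<open>p\<close> that is further away.\<close>

lemma geodesic_joined_off:
  assumes m: "geodesic_space m" and x: "x \<in> mspace m" and y: "y \<in> mspace m"
    and p: "p \<in> mspace m" and less: "mdist m x y < mdist m x p"
  shows "joined_off m p x y"
proof -
  obtain \<gamma> where \<gamma>: "\<gamma> 0 = x" "\<gamma> 1 = y" "\<And>t. t \<in> {0..1} \<Longrightarrow> \<gamma> t \<in> mspace m"
    "\<And>s t. s \<in> {0..1} \<Longrightarrow> t \<in> {0..1} \<Longrightarrow> mdist m (\<gamma> s) (\<gamma> t) = \<bar>s - t\<bar> * mdist m x y"
    using geodesicE[OF m x y] by blast
  have "\<gamma> t \<noteq> p" if t: "t \<in> {0..1}" for t
  proof
    assume "\<gamma> t = p"
    then have "mdist m x p = t * mdist m x y" using \<gamma>(4)[of 0 t] \<gamma>(1) t by simp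
    also have "\<dots> \<le> mdist m x y" using t by (simp add: mult_left_le_one_le)
    finally show False using less by simp
  qed
  then show ?thesis
    using Lipschitz_curve_joined_off[of \<gamma> m p "mdist m x y"] \<gamma> by (auto simp: mult.commute)
qed

text \<open>An isometry is injective, so it carries paths that avoid \<open>q\<close> to paths that avoid the image of
  \<open>q\<close>.\<close>

lemma isometry_joined_off:
  assumes f: "\<And>x. x \<in> mspace m \<Longrightarrow> f x \<in> mspace m"
    and iso: "\<And>x y. x \<in> mspace m \<Longrightarrow> y \<in> mspace m \<Longrightarrow> mdist m (f x) (f y) = mdist m x y"
    and q: "q \<in> mspace m" and j: "joined_off m q x y"
  shows "joined_off m (f q) (f x) (f y)"
proof -
  have "Lipschitz_continuous_map m m f"
    unfolding Lipschitz_continuous_map_def using f iso by (auto intro!: exI[of _ 1])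
  then have c: "continuous_map (mtopology_of m) (mtopology_of m) f"
    by (rule Lipschitz_continuous_imp_continuous_map)
  have "f x \<noteq> f q" if "x \<in> mspace m" "x \<noteq> q" for x
  proof
    assume "f x = f q"
    then have "mdist m x q = 0" using iso[OF that(1) q] mdist_refl[OF f[OF q]] by simp
    then show False using Metric_space.zero[OF Metric_space_mspace_mdist that(1) q] that(2) by simp
  qed
  then have "continuous_map (subtopology (mtopology_of m) (mspace m - {q}))
      (subtopology (mtopology_of m) (mspace m - {f q})) f"
    using c f by (auto simp: continuous_map_in_subtopology continuous_map_from_subtopology)
  then show ?thesis
    using j unfolding joined_off_def by (metis path_component_of_continuous_image)
qed

text \<open>These are the Clifford translations of metric geometry, without surjectivity. Right
  multiplication by a central element of a group is one for every word metric.\<close>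

definition translation :: "'a metric \<Rightarrow> real \<Rightarrow> ('a \<Rightarrow> 'a) \<Rightarrow> bool" where
  "translation m \<epsilon> f \<longleftrightarrow>
     (\<forall>x\<in>mspace m. f x \<in> mspace m \<and> mdist m x (f x) = \<epsilon>) \<and>
     (\<forall>x\<in>mspace m. \<forall>y\<in>mspace m. mdist m (f x) (f y) = mdist m x y)"

text \<open>Follow a geodesic from \<open>v\<close> to \<open>p\<close>. If it passes through \<open>f p\<close>, then \<open>f p\<close> is
  strictly between \<open>v\<close> and \<open>p\<close>: it is closer to \<open>v\<close> than \<open>p\<close> is, by exactly \<open>\<epsilon>\<close>, and is
  reached from \<open>v\<close> before \<open>p\<close>. If it avoids \<open>f p\<close>, apply \<open>g\<close>: the image joins \<open>g v\<close> to
  \<open>g p\<close> and avoids \<open>g (f p) = p\<close>. Since \<open>g v\<close> is within \<open>\<epsilon>\<close> of \<open>v\<close>, and \<open>p\<close> is further away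
  than that, \<open>v\<close> and \<open>g v\<close> are joined off \<open>p\<close> as well.\<close>

lemma joined_off_translate:
  assumes m: "geodesic_space m" and p: "p \<in> mspace m" and v: "v \<in> mspace m"
    and f: "translation m \<epsilon> f" and g: "translation m \<epsilon> g" and gf: "g (f p) = p"
    and \<epsilon>: "0 < \<epsilon>" "\<epsilon> < mdist m v p"
  shows "joined_off m p v (g p) \<or> joined_off m p v (f p) \<and> mdist m v (f p) = mdist m v p - \<epsilon>"
proof -
  have fp: "f p \<in> mspace m" "mdist m p (f p) = \<epsilon>"
    and gM: "\<And>x. x \<in> mspace m \<Longrightarrow> g x \<in> mspace m" and gd: "mdist m v (g v) = \<epsilon>"
    and iso: "\<And>x y. x \<in> mspace m \<Longrightarrow> y \<in> mspace m \<Longrightarrow> mdist m (g x) (g y) = mdist m x y"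
    using f g p v by (auto simp: translation_def)
  let ?D = "mdist m v p"
  obtain \<gamma> where \<gamma>: "\<gamma> 0 = v" "\<gamma> 1 = p" "\<And>t. t \<in> {0..1} \<Longrightarrow> \<gamma> t \<in> mspace m"
    "\<And>s t. s \<in> {0..1} \<Longrightarrow> t \<in> {0..1} \<Longrightarrow> mdist m (\<gamma> s) (\<gamma> t) = \<bar>s - t\<bar> * ?D"
    using geodesicE[OF m v p] by blast
  show ?thesis
  proof (cases "\<exists>t\<in>{0..1}. \<gamma> t = f p")
    case True
    then obtain t where t: "t \<in> {0..1}" "\<gamma> t = f p" by blast
    have "mdist m (\<gamma> t) (\<gamma> 1) = \<bar>t - 1\<bar> * ?D" "mdist m (\<gamma> 0) (\<gamma> t) = \<bar>0 - t\<bar> * ?D"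
      using \<gamma>(4)[of t 1] \<gamma>(4)[of 0 t] t by auto
    then have "\<epsilon> = (1 - t) * ?D" "mdist m v (f p) = t * ?D"
      using t \<gamma> fp by (auto simp: mdist_sym)
    then have d: "mdist m v (f p) = ?D - \<epsilon>" by (simp add: algebra_simps)
    then have "joined_off m p v (f p)"
      using \<epsilon> by (intro geodesic_joined_off[OF m v fp(1) p]) auto
    with d show ?thesis by simp
  next
    case False
    then have "joined_off m (f p) v p"
      using Lipschitz_curve_joined_off[of \<gamma> m "f p" ?D] \<gamma> by (auto simp: mult.commute)
    then have "joined_off m p (g v) (g p)"
      using isometry_joined_off[of m g, OF gM iso fp(1), of v p] gf by simp
    moreover have "joined_off m p v (g v)"
      using \<epsilon> gd gM v by (intro geodesic_joined_off[OF m v _ p]) auto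
    ultimately show ?thesis by (auto intro: joined_off_trans)
  qed
qed

text \<open>The point \<open>y\<close> is a hub of the complement of \<open>p\<close>. No translate of \<open>p\<close> is closer to \<open>y\<close> than
  \<open>p\<close> itself, so the second alternative of \<open>joined_off_translate\<close> is impossible for \<open>y\<close>, and
  \<open>y\<close> is joined to both \<open>f p\<close> and \<open>g p\<close>. Any other \<open>v\<close> is joined to one of the two, as soon as the
  translation length is smaller than its distance to \<open>p\<close>, and hence to \<open>y\<close>.\<close>

theorem no_cut_point_if_translations:
  assumes m: "geodesic_space m" and p: "p \<in> mspace m" and y: "y \<in> mspace m" "y \<noteq> p"
    and trans: "\<And>\<epsilon>. 0 < \<epsilon> \<Longrightarrow> \<exists>f g. translation m \<epsilon> f \<and> translation m \<epsilon> g \<and> f (g p) = p \<and> g (f p) = p \<and>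
        mdist m y p \<le> mdist m y (f p) \<and> mdist m y p \<le> mdist m y (g p)"
  shows "\<not> cut_point (mtopology_of m) p"
proof -
  have pos: "0 < mdist m v p" if "v \<in> mspace m" "v \<noteq> p" for v
    using Metric_space.mdist_pos_less[OF Metric_space_mspace_mdist that(2,1) p] .
  have join: "joined_off m p v y" if v: "v \<in> mspace m" "v \<noteq> p" for v
  proof -
    define \<epsilon> where "\<epsilon> = min (mdist m v p) (mdist m y p) / 2"
    have \<epsilon>: "0 < \<epsilon>" "\<epsilon> < mdist m v p" "\<epsilon> < mdist m y p"
      using pos[OF v] pos[OF y] unfolding \<epsilon>_def by linarith+
    obtain f g where f: "translation m \<epsilon> f" "f (g p) = p" and g: "translation m \<epsilon> g" "g (f p) = p"
      and far: "mdist m y p \<le> mdist m y (f p)" "mdist m y p \<le> mdist m y (g p)"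
      using trans[OF \<epsilon>(1)] by (elim exE conjE)
    have "joined_off m p y (g p)"
      using joined_off_translate[OF m p y(1) f(1) g \<epsilon>(1,3)] far \<epsilon>(1) by linarith
    moreover have "joined_off m p y (f p)"
      using joined_off_translate[OF m p y(1) g(1) f \<epsilon>(1,3)] far \<epsilon>(1) by linarith
    moreover have "joined_off m p v (g p) \<or> joined_off m p v (f p)"
      using joined_off_translate[OF m p v(1) f(1) g \<epsilon>(1,2)] by blast
    ultimately show ?thesis
      by (meson joined_off_trans joined_off_sym)
  qed
  have "joined_off m p u v" if "u \<in> mspace m - {p}" "v \<in> mspace m - {p}" for u v
    using joined_off_trans[OF join joined_off_sym[OF join]] that by simp
  then have "path_connected_space (subtopology (mtopology_of m) (mspace m - {p}))"
    by (simp add: path_connected_space_iff_path_component joined_off_def)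
  then show ?thesis using y by (auto simp: cut_point_def)
qed

section \<open>Ultralimits inherit geodesics and translations\<close>

locale pointed_ultralimit =
  fixes \<omega> :: "'i filter" and X :: "'i \<Rightarrow> 'a metric" and b :: "'i \<Rightarrow> 'a"
  assumes nonprincipal: "nonprincipal_ultrafilter \<omega>" and base: "b i \<in> mspace (X i)"
begin

abbreviation "\<S> \<equiv> ulim_seqs \<omega> X b"
abbreviation "\<L> \<equiv> ultralimit \<omega> X b"

definition pt :: "('i \<Rightarrow> 'a) \<Rightarrow> ('i \<Rightarrow> 'a) set" where
  "pt x = ulim_rel \<omega> X b `` {x}"

lemma nontrivial: "\<omega> \<noteq> bot"
  using nonprincipal by (simp add: nonprincipal_ultrafilter_def)

lemma seqs_mspace: "x \<in> \<S> \<Longrightarrow> x i \<in> mspace (X i)"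
  by (simp add: ulim_seqs_def)

lemma seqs_dist_tendsto:
  assumes "x \<in> \<S>" "y \<in> \<S>"
  shows "((\<lambda>i. mdist (X i) (x i) (y i)) \<longlongrightarrow> ulim_pdist \<omega> X x y) \<omega>"
  using ulim_pdist_tendsto[OF nonprincipal base assms] by simp

lemma pt_in: "x \<in> \<S> \<Longrightarrow> pt x \<in> mspace \<L>"
  using nonprincipal base by (simp add: pt_def ulim_space_def quotientI)

lemma pt_surj:
  assumes "A \<in> mspace \<L>" obtains x where "x \<in> \<S>" "A = pt x"
  using assms nonprincipal base by (auto simp: pt_def ulim_space_def elim: quotientE)

lemma pt_dist_tendsto:
  assumes x: "x \<in> \<S>" and y: "y \<in> \<S>"
  shows "((\<lambda>i. mdist (X i) (x i) (y i)) \<longlongrightarrow> mdist \<L> (pt x) (pt y)) \<omega>"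
proof -
  have "z \<in> pt z \<and> pt z \<in> ulim_space \<omega> X b" if "z \<in> \<S>" for z
    using equiv_class_self[OF equiv_ulim_rel[OF nonprincipal base] that] quotientI[OF that]
    by (simp add: pt_def ulim_space_def)
  then have "ulim_dist \<omega> X b (pt x) (pt y) = ulim_pdist \<omega> X x y"
    using x y by (intro ulim_dist_class[OF nonprincipal base]) auto
  then show ?thesis
    using seqs_dist_tendsto[OF x y] nonprincipal base by simp
qed

lemma pt_dist_eqI:
  assumes "x \<in> \<S>" "y \<in> \<S>" "((\<lambda>i. mdist (X i) (x i) (y i)) \<longlongrightarrow> r) \<omega>"
  shows "mdist \<L> (pt x) (pt y) = r"
  using tendsto_unique[OF nontrivial pt_dist_tendsto[OF assms(1,2)] assms(3)] .

text \<open>A sequence at finite limiting distance from a sequence of the ultralimit belongs to the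
  ultralimit too, by the triangle inequality and compactness of bounded intervals.\<close>

lemma seqsI:
  assumes x: "x \<in> \<S>" and y: "\<And>i. y i \<in> mspace (X i)"
    and lim: "((\<lambda>i. mdist (X i) (x i) (y i)) \<longlongrightarrow> r) \<omega>"
  shows "y \<in> \<S>"
proof -
  obtain l where l: "((\<lambda>i. mdist (X i) (x i) (b i)) \<longlongrightarrow> l) \<omega>"
    using x ulim_seqs_iff[OF nonprincipal] by metis
  have "eventually (\<lambda>i. mdist (X i) (x i) (b i) < l + 1) \<omega>"
    "eventually (\<lambda>i. mdist (X i) (x i) (y i) < r + 1) \<omega>"
    using order_tendstoD(2)[OF l] order_tendstoD(2)[OF lim] by simp_all
  then have "eventually (\<lambda>i. mdist (X i) (y i) (b i) \<in> {0..l + r + 2}) \<omega>"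
  proof eventually_elim
    case (elim i)
    have "mdist (X i) (y i) (b i) \<le> mdist (X i) (x i) (y i) + mdist (X i) (x i) (b i)"
      using mdist_triangle[OF y seqs_mspace[OF x] base, of i] by (simp add: mdist_sym)
    with elim show ?case by (simp add: mdist_ge_0)
  qed
  then have "\<exists>k\<in>{0..l + r + 2}. ((\<lambda>i. mdist (X i) (y i) (b i)) \<longlongrightarrow> k) \<omega>"
    by (rule ultrafilter_tendsto_compact[OF nonprincipal compact_Icc])
  then show ?thesis
    using y ulim_seqs_iff[OF nonprincipal, of y X b] by auto
qed

text \<open>A sequence of translations moves every sequence of the ultralimit a bounded distance, so it acts
  on the ultralimit whatever the base points are, even if it does not fix them.\<close>

lemma translation_ultralimit:
  assumes \<phi>: "\<And>i. translation (X i) (\<delta> i) (\<phi> i)" and \<delta>: "(\<delta> \<longlongrightarrow> \<epsilon>) \<omega>"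
  obtains F where "translation \<L> \<epsilon> F"
    "\<And>x. x \<in> \<S> \<Longrightarrow> (\<lambda>i. \<phi> i (x i)) \<in> \<S>" "\<And>x. x \<in> \<S> \<Longrightarrow> F (pt x) = pt (\<lambda>i. \<phi> i (x i))"
proof -
  have disp: "mdist (X i) (x i) (\<phi> i (x i)) = \<delta> i" and \<phi>M: "\<phi> i (x i) \<in> mspace (X i)"
    if "x \<in> \<S>" for x i
    using \<phi>[of i] seqs_mspace[OF that] by (auto simp: translation_def)
  have iso: "mdist (X i) (\<phi> i (x i)) (\<phi> i (y i)) = mdist (X i) (x i) (y i)"
    if "x \<in> \<S>" "y \<in> \<S>" for x y i
    using \<phi>[of i] seqs_mspace[OF that(1)] seqs_mspace[OF that(2)] by (auto simp: translation_def)
  have \<phi>S: "(\<lambda>i. \<phi> i (x i)) \<in> \<S>" if x: "x \<in> \<S>" for x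
    by (rule seqsI[OF x, of _ \<epsilon>]) (use \<delta> disp[OF x] \<phi>M[OF x] in auto)
  have isoL: "mdist \<L> (pt (\<lambda>i. \<phi> i (x i))) (pt (\<lambda>i. \<phi> i (y i))) = mdist \<L> (pt x) (pt y)"
    if "x \<in> \<S>" "y \<in> \<S>" for x y
    using pt_dist_tendsto[OF that] iso[OF that] by (intro pt_dist_eqI \<phi>S that) simp
  \<comment> \<open>Choosing a representative is harmless: by the isometry property, equivalent sequences have equivalent images.\<close>
  define F where "F A = pt (\<lambda>i. \<phi> i ((SOME x. x \<in> \<S> \<and> A = pt x) i))" for A
  have F: "F (pt x) = pt (\<lambda>i. \<phi> i (x i))" if x: "x \<in> \<S>" for x
  proof -
    define x' where "x' = (SOME x'. x' \<in> \<S> \<and> pt x = pt x')"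
    have x': "x' \<in> \<S>" "pt x = pt x'"
      unfolding x'_def using someI[of "\<lambda>x'. x' \<in> \<S> \<and> pt x = pt x'" x] x by auto
    have "mdist \<L> (pt (\<lambda>i. \<phi> i (x' i))) (pt (\<lambda>i. \<phi> i (x i))) = 0"
      using isoL[OF x'(1) x] x'(2) mdist_refl[OF pt_in[OF x]] by simp
    then have "pt (\<lambda>i. \<phi> i (x' i)) = pt (\<lambda>i. \<phi> i (x i))"
      using Metric_space.zero[OF Metric_space_mspace_mdist pt_in[OF \<phi>S[OF x'(1)]] pt_in[OF \<phi>S[OF x]]]
      by blast
    then show ?thesis by (simp add: F_def x'_def)
  qed
  have "translation \<L> \<epsilon> F"
    unfolding translation_def
  proof (intro conjI ballI)
    fix A assume "A \<in> mspace \<L>"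
    then obtain x where x: "x \<in> \<S>" "A = pt x" by (rule pt_surj)
    show "F A \<in> mspace \<L>" using x F pt_in \<phi>S by simp
    show "mdist \<L> A (F A) = \<epsilon>"
      using pt_dist_eqI[OF x(1) \<phi>S[OF x(1)]] \<delta> disp[OF x(1)] F[OF x(1)] x(2) by simp
    fix B assume "B \<in> mspace \<L>"
    then obtain y where y: "y \<in> \<S>" "B = pt y" by (rule pt_surj)
    show "mdist \<L> (F A) (F B) = mdist \<L> A B"
      using isoL[OF x(1) y(1)] F x y by simp
  qed
  then show thesis using \<phi>S F that by blast
qed

end

text \<open>Any two points are joined by a chain that is isometric to \<open>{0, \<dots>, l}\<close> with spacing \<open>c\<close>: the
  shape of a word metric scaled by \<open>c\<close>, where the vertices of a Cayley graph are present but not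
  its edges.\<close>

definition discretely_geodesic :: "'a metric \<Rightarrow> real \<Rightarrow> bool" where
  "discretely_geodesic m c \<longleftrightarrow>
     (\<forall>x\<in>mspace m. \<forall>y\<in>mspace m. \<exists>h (l::nat).
        h 0 = x \<and> h l = y \<and> (\<forall>j\<le>l. h j \<in> mspace m) \<and>
        (\<forall>j\<le>l. \<forall>k\<le>l. mdist m (h j) (h k) = c * \<bar>real j - real k\<bar>))"

lemma floor_difference_bound: "\<bar>\<bar>real_of_int \<lfloor>a\<rfloor> - real_of_int \<lfloor>b\<rfloor>\<bar> - \<bar>a - b\<bar>\<bar> \<le> 1"
  by linarith

text \<open>The geodesic at time \<open>t\<close> is the class of the sequence of \<open>\<lfloor>t l\<rfloor>\<close>-th points of the chains, \<open>l\<close>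
  being the length of the respective chain. Rounding costs at most one spacing, and the spacings
  tend to \<open>0\<close>.\<close>

lemma (in pointed_ultralimit) geodesic_ultralimit:
  assumes X: "\<And>i. discretely_geodesic (X i) (c i)" and c0: "\<And>i. 0 \<le> c i" and c: "(c \<longlongrightarrow> 0) \<omega>"
  shows "geodesic_space \<L>"
  unfolding geodesic_space_def
proof (intro ballI)
  fix A B assume "A \<in> mspace \<L>" "B \<in> mspace \<L>"
  then obtain x y where x: "x \<in> \<S>" "A = pt x" and y: "y \<in> \<S>" "B = pt y"
    by (metis pt_surj)
  let ?D = "mdist \<L> A B"
  have "\<forall>i. \<exists>h (l::nat). h 0 = x i \<and> h l = y i \<and> (\<forall>j\<le>l. h j \<in> mspace (X i)) \<and>
      (\<forall>j\<le>l. \<forall>k\<le>l. mdist (X i) (h j) (h k) = c i * \<bar>real j - real k\<bar>)"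
    using X seqs_mspace[OF x(1)] seqs_mspace[OF y(1)] unfolding discretely_geodesic_def by blast
  then obtain h l where h0: "\<And>i. h i 0 = x i" and hl: "\<And>i. h i (l i) = y i"
    and hM: "\<And>i j. j \<le> l i \<Longrightarrow> h i j \<in> mspace (X i)"
    and hd: "\<And>i j k. j \<le> l i \<Longrightarrow> k \<le> l i \<Longrightarrow> mdist (X i) (h i j) (h i k) = c i * \<bar>real j - real k\<bar>"
    by metis
  have "mdist (X i) (x i) (y i) = c i * real (l i)" for i
    using hd[of 0 i "l i"] h0 hl by simp
  then have D: "((\<lambda>i. c i * real (l i)) \<longlongrightarrow> ?D) \<omega>"
    using pt_dist_tendsto[OF x(1) y(1)] x(2) y(2) by simp
  define n where "n t i = nat \<lfloor>t * real (l i)\<rfloor>" for t :: real and i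
  have n_le: "n t i \<le> l i" if "t \<in> {0..1}" for t i
  proof -
    have "t * real (l i) \<le> real (l i)" using that by (simp add: mult_left_le_one_le)
    then show ?thesis unfolding n_def by linarith
  qed
  have d_lim: "((\<lambda>i. mdist (X i) (h i (n s i)) (h i (n t i))) \<longlongrightarrow> \<bar>s - t\<bar> * ?D) \<omega>"
    if s: "s \<in> {0..1}" and t: "t \<in> {0..1}" for s t
  proof -
    let ?e = "\<lambda>i. mdist (X i) (h i (n s i)) (h i (n t i)) - \<bar>s - t\<bar> * (c i * real (l i))"
    have "\<bar>?e i\<bar> \<le> c i" for i
    proof -
      have nn: "real (n s i) = real_of_int \<lfloor>s * real (l i)\<rfloor>" "real (n t i) = real_of_int \<lfloor>t * real (l i)\<rfloor>"
        using s t by (simp_all add: n_def)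
      have "\<bar>s * real (l i) - t * real (l i)\<bar> = \<bar>s - t\<bar> * real (l i)"
        by (simp add: abs_mult flip: left_diff_distrib)
      then have "?e i = c i * (\<bar>real (n s i) - real (n t i)\<bar> - \<bar>s * real (l i) - t * real (l i)\<bar>)"
        using hd[OF n_le[OF s] n_le[OF t]] by (simp add: algebra_simps)
      then show ?thesis
        using mult_left_mono[OF floor_difference_bound[of "s * real (l i)" "t * real (l i)"] c0[of i]] c0[of i]
        unfolding nn by (simp add: abs_mult)
    qed
    then have "(?e \<longlongrightarrow> 0) \<omega>"
      by (intro tendsto_rabs_zero_cancel[OF tendsto_sandwich[OF _ _ tendsto_const c]]) auto
    from tendsto_add[OF this tendsto_mult_left[OF D, of "\<bar>s - t\<bar>"]] show ?thesis by simp
  qed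
  have S: "(\<lambda>i. h i (n t i)) \<in> \<S>" if t: "t \<in> {0..1}" for t
    using d_lim[of 0 t] t hM[OF n_le[OF t]]
    by (intro seqsI[OF x(1), of _ "\<bar>0 - t\<bar> * ?D"]) (auto simp: n_def h0)
  define \<gamma> where "\<gamma> t = pt (\<lambda>i. h i (n t i))" for t
  show "\<exists>\<gamma>::real \<Rightarrow> _. \<gamma> 0 = A \<and> \<gamma> 1 = B \<and> (\<forall>t\<in>{0..1}. \<gamma> t \<in> mspace \<L>) \<and>
        (\<forall>s\<in>{0..1}. \<forall>t\<in>{0..1}. mdist \<L> (\<gamma> s) (\<gamma> t) = \<bar>s - t\<bar> * ?D)"
  proof (intro exI[of _ \<gamma>] conjI ballI)
    show "\<gamma> 0 = A" "\<gamma> 1 = B" by (simp_all add: \<gamma>_def n_def h0 hl x(2) y(2))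
    show "\<gamma> t \<in> mspace \<L>" if "t \<in> {0..1}" for t unfolding \<gamma>_def by (rule pt_in[OF S[OF that]])
    show "mdist \<L> (\<gamma> s) (\<gamma> t) = \<bar>s - t\<bar> * ?D" if "s \<in> {0..1}" "t \<in> {0..1}" for s t
      unfolding \<gamma>_def by (intro pt_dist_eqI S d_lim that)
  qed
qed

section \<open>Lengths in finitely generated groups\<close>

context group
begin

lemma shortest_word:
  assumes "finite_generating_set G S" "g \<in> carrier G"
  obtains ws where "length ws = word_length G S g" "set ws \<subseteq> S \<union> m_inv G ` S" "word_prod G ws = g"
proof -
  have "\<exists>ws. set ws \<subseteq> S \<union> m_inv G ` S \<and> word_prod G ws = g"
    using assms word_exists[of S g] by (simp add: finite_generating_set_def)
  then have "\<exists>n ws. length ws = n \<and> set ws \<subseteq> S \<union> m_inv G ` S \<and> word_prod G ws = g"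
    by blast
  from LeastI_ex[OF this] show thesis
    using that unfolding word_length_def by blast
qed

lemma word_length_le:
  "set ws \<subseteq> S \<union> m_inv G ` S \<Longrightarrow> word_length G S (word_prod G ws) \<le> length ws"
  unfolding word_length_def by (intro Least_le) auto

lemma letters_in_carrier: "finite_generating_set G S \<Longrightarrow> S \<union> m_inv G ` S \<subseteq> carrier G"
  by (auto simp: finite_generating_set_def)

lemma word_length_mult:
  assumes S: "finite_generating_set G S" and g: "g \<in> carrier G" and h: "h \<in> carrier G"
  shows "word_length G S (g \<otimes> h) \<le> word_length G S g + word_length G S h"
proof -
  obtain us where us: "length us = word_length G S g" "set us \<subseteq> S \<union> m_inv G ` S" "word_prod G us = g"
    using shortest_word[OF S g] .
  obtain vs where vs: "length vs = word_length G S h" "set vs \<subseteq> S \<union> m_inv G ` S" "word_prod G vs = h"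
    using shortest_word[OF S h] .
  have "set (us @ vs) \<subseteq> S \<union> m_inv G ` S" using us(2) vs(2) by simp
  from word_length_le[OF this] show ?thesis
    using word_prod_append[of us vs] us vs letters_in_carrier[OF S] by (simp add: subset_trans)
qed

lemma word_length_one: "word_length G S \<one> = 0"
  using word_length_le[of "[]" S] by (simp add: word_prod_def)

lemma word_length_inv:
  assumes S: "finite_generating_set G S" and g: "g \<in> carrier G"
  shows "word_length G S (inv g) = word_length G S g"
  using Metric_space.commute[OF Metric_space_word_dist[OF S], of g \<one>] g
  by (simp add: word_dist_def)

lemma finite_word_ball:
  assumes S: "finite_generating_set G S"
  shows "finite {g \<in> carrier G. word_length G S g \<le> r}"
proof (rule finite_subset)
  show "{g \<in> carrier G. word_length G S g \<le> r}
      \<subseteq> word_prod G ` {ws. set ws \<subseteq> S \<union> m_inv G ` S \<and> length ws \<le> r}"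
  proof
    fix g assume "g \<in> {g \<in> carrier G. word_length G S g \<le> r}"
    then show "g \<in> word_prod G ` {ws. set ws \<subseteq> S \<union> m_inv G ` S \<and> length ws \<le> r}"
      by (auto elim!: shortest_word[OF S, of g])
  qed
  show "finite (word_prod G ` {ws. set ws \<subseteq> S \<union> m_inv G ` S \<and> length ws \<le> r})"
    using S by (intro finite_imageI finite_lists_length_le) (simp add: finite_generating_set_def)
qed

text \<open>The prefixes of a shortest word form the chain. A subword bounds the distance of two of them
  from above. It cannot be smaller, or the chain would reveal a shorter word.\<close>

lemma word_metric_discretely_geodesic:
  assumes S: "finite_generating_set G S" and c: "0 < c"
  shows "discretely_geodesic (rescale c (word_metric G S)) c"
  unfolding discretely_geodesic_def rescale_simps[OF c] word_metric_simps[OF S]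
proof (intro ballI)
  fix x y assume x: "x \<in> carrier G" and y: "y \<in> carrier G"
  let ?A = "S \<union> m_inv G ` S" and ?d = "word_dist G S"
  interpret W: Metric_space "carrier G" ?d by (rule Metric_space_word_dist[OF S])
  obtain ws where ws: "length ws = word_length G S (inv x \<otimes> y)" "set ws \<subseteq> ?A"
      "word_prod G ws = inv x \<otimes> y"
    using shortest_word[OF S m_closed[OF inv_closed[OF x] y]] .
  define h where "h j = x \<otimes> word_prod G (take j ws)" for j
  have sub: "set (take j ws) \<subseteq> carrier G" "set (drop j ws) \<subseteq> carrier G"
    "set (take j (drop k ws)) \<subseteq> ?A" for j k
    using ws(2) letters_in_carrier[OF S] by (meson set_take_subset set_drop_subset subset_trans)+
  have hM: "h j \<in> carrier G" for j using x word_prod_closed[OF sub(1)] by (simp add: h_def)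
  have le: "?d (h j) (h k) \<le> real (k - j)" if "j \<le> k" for j k
  proof -
    define u where "u = take (k - j) (drop j ws)"
    have u: "set u \<subseteq> ?A" "length u \<le> k - j" using sub(3) by (simp_all add: u_def)
    have uG: "set u \<subseteq> carrier G" using u(1) letters_in_carrier[OF S] by (rule subset_trans)
    have "take k ws = take j ws @ u" using that by (simp add: u_def flip: take_add)
    then have "h k = h j \<otimes> word_prod G u"
      using x word_prod_append[OF sub(1) uG] word_prod_closed[OF sub(1)] word_prod_closed[OF uG]
      by (simp add: h_def m_assoc)
    then have "inv (h j) \<otimes> h k = word_prod G u"
      using hM word_prod_closed[OF uG] by (simp add: inv_solve_left')
    then show ?thesis
      using word_length_le[OF u(1)] u(2) hM by (simp add: word_dist_def)
  qed
  let ?l = "length ws"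
  have h0: "h 0 = x" using x by (simp add: h_def word_prod_def)
  have hl: "h ?l = y" using x y ws(3) by (simp add: h_def flip: m_assoc)
  have total: "?d x y = real ?l" using x y ws(1) by (simp add: word_dist_def)
  have eq: "?d (h j) (h k) = real k - real j" if jk: "j \<le> k" "k \<le> ?l" for j k
  proof -
    have "?d x y \<le> ?d x (h j) + ?d (h j) (h k) + ?d (h k) y"
      using W.triangle[OF x hM y, of k] W.triangle[OF x hM[of j] hM[of k]] by linarith
    moreover have "?d x (h j) \<le> real j" using le[of 0 j] h0 by simp
    moreover have "?d (h k) y \<le> real (?l - k)" using le[of k ?l] hl jk by simp
    ultimately show ?thesis using le[OF jk(1)] total jk by simp
  qed
  have "?d (h j) (h k) = \<bar>real j - real k\<bar>" if "j \<le> ?l" "k \<le> ?l" for j k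
    using eq[of j k] eq[of k j] that W.commute[of "h j" "h k"] by (cases "j \<le> k") auto
  then show "\<exists>h l. h 0 = x \<and> h l = y \<and> (\<forall>j\<le>l. h j \<in> carrier G) \<and>
      (\<forall>j\<le>l. \<forall>k\<le>l. c * ?d (h j) (h k) = c * \<bar>real j - real k\<bar>)"
    using h0 hl hM by (intro exI[of _ h] exI[of _ ?l]) simp
qed

lemma central_translation:
  assumes S: "finite_generating_set G S" and c: "0 < c" and z: "z \<in> carrier G"
    and central: "\<And>g. g \<in> carrier G \<Longrightarrow> z \<otimes> g = g \<otimes> z"
  shows "translation (rescale c (word_metric G S)) (c * word_length G S z) (\<lambda>g. g \<otimes> z)"
  unfolding translation_def rescale_simps[OF c] word_metric_simps[OF S]
proof (intro conjI ballI)
  fix x assume x: "x \<in> carrier G"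
  show "x \<otimes> z \<in> carrier G" using x z by simp
  have "inv x \<otimes> (x \<otimes> z) = z" using x z by (simp flip: m_assoc)
  then show "c * word_dist G S x (x \<otimes> z) = c * word_length G S z"
    using x z by (simp add: word_dist_def)
  fix y assume y: "y \<in> carrier G"
  have "inv (x \<otimes> z) \<otimes> (y \<otimes> z) = inv x \<otimes> y"
  proof -
    have "inv (x \<otimes> z) \<otimes> (y \<otimes> z) = inv (x \<otimes> z) \<otimes> (z \<otimes> y)" using central[OF y] by simp
    also have "\<dots> = inv (z \<otimes> x) \<otimes> (z \<otimes> y)" using central[OF x] by simp
    also have "\<dots> = inv x \<otimes> (inv z \<otimes> (z \<otimes> y))"
      using x y z by (simp add: inv_mult_group m_assoc)
    also have "inv z \<otimes> (z \<otimes> y) = y" using y z by (simp flip: m_assoc)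
    finally show ?thesis .
  qed
  then show "c * word_dist G S (x \<otimes> z) (y \<otimes> z) = c * word_dist G S x y"
    using x y z by (simp add: word_dist_def)
qed

text \<open>Along the powers of a generator \<open>a\<close> the length grows by at most the length of \<open>a\<close> in each step, so
  it skips no window of that width. It is unbounded since balls are finite. The lengths of the
  powers need not be monotone; cyclic subgroups may be arbitrarily distorted.\<close>

lemma cyclic_subgroup_lengths:
  assumes S: "finite_generating_set G S" and Z: "subgroup Z G"
    and cyc: "cyclic_group (G\<lparr>carrier := Z\<rparr>)" and inf: "infinite Z"
  obtains C where "\<And>r. \<exists>z\<in>Z. r \<le> word_length G S z \<and> word_length G S z \<le> r + C"
proof -
  interpret H: group "G\<lparr>carrier := Z\<rparr>" by (rule subgroup.subgroup_is_group[OF Z is_group])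
  obtain a where a: "a \<in> Z" "Z = range (\<lambda>n::int. a [^]\<^bsub>G\<lparr>carrier := Z\<rparr>\<^esub> n)"
    using cyc unfolding H.cyclic_group by auto
  have aG: "a \<in> carrier G" and ZG: "Z \<subseteq> carrier G"
    using a(1) Z subgroup.subset by auto
  have Zpow: "Z = range (\<lambda>n::int. a [^] n)"
    using a int_pow_consistent[OF Z a(1)] by simp
  let ?L = "\<lambda>k::nat. word_length G S (a [^] k)"
  have unbounded: "\<exists>k::nat. r \<le> ?L k" for r
  proof (rule ccontr)
    assume neg: "\<nexists>k. r \<le> ?L k"
    have "Z \<subseteq> {g \<in> carrier G. word_length G S g \<le> r}"
    proof
      fix z assume "z \<in> Z"
      then obtain n :: int where n: "z = a [^] n" unfolding Zpow by blast
      have "word_length G S z = ?L (nat \<bar>n\<bar>)"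
      proof (cases "n \<ge> 0")
        case True
        then have "z = a [^] nat \<bar>n\<bar>" unfolding n int_pow_def2 by auto
        then show ?thesis by (rule arg_cong)
      next
        case False
        then have "z = inv (a [^] nat \<bar>n\<bar>)" unfolding n int_pow_def2 by auto
        then show ?thesis using word_length_inv[OF S nat_pow_closed[OF aG]] by metis
      qed
      then show "z \<in> {g \<in> carrier G. word_length G S g \<le> r}"
        using neg ZG \<open>z \<in> Z\<close> by (metis (mono_tags, lifting) linear mem_Collect_eq subsetD)
    qed
    then show False using inf finite_word_ball[OF S] finite_subset by blast
  qed
  have "\<exists>z\<in>Z. r \<le> word_length G S z \<and> word_length G S z \<le> r + word_length G S a" for r
  proof -
    \<comment> \<open>The first power of length at least r; the previous power is shorter than r.\<close>
    define k where "k = (LEAST k. r \<le> ?L k)"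
    have k: "r \<le> ?L k" unfolding k_def using LeastI_ex[OF unbounded] .
    have "?L k \<le> r + word_length G S a"
    proof (cases k)
      case 0
      then show ?thesis by (simp add: word_length_one)
    next
      case (Suc j)
      then have "\<not> r \<le> ?L j" unfolding k_def by (metis lessI not_less_Least)
      moreover have "?L k \<le> ?L j + word_length G S a"
        using Suc aG word_length_mult[OF S, of "a [^] j" a] by simp
      ultimately show ?thesis by linarith
    qed
    moreover have "a [^] k \<in> Z"
      unfolding Zpow by (metis int_pow_int rangeI)
    ultimately show ?thesis using k by blast
  qed
  then show thesis using that by blast
qed

text \<open>In the coset space of an infinite index subgroup the balls are finite, so some coset is at
  distance at least \<open>r\<close> from the trivial one. Take a shortest representative \<open>g\<close> of such a coset:
  on a shortest word for \<open>g\<close> the length and the distance to the subgroup agree at every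
  prefix, because the remaining letters could not make up for a loss. The prefix of length \<open>r\<close> is the
  element wanted.\<close>

lemma far_from_infinite_index_subgroup:
  assumes S: "finite_generating_set G S" and Z: "subgroup Z G" and inf: "infinite (rcosets Z)"
  obtains g where "g \<in> carrier G" "word_length G S g = r"
    "\<And>z. z \<in> Z \<Longrightarrow> r \<le> word_length G S (inv z \<otimes> g)"
proof -
  let ?A = "S \<union> m_inv G ` S"
  have ZG: "Z \<subseteq> carrier G" using Z subgroup.subset by blast
  have "\<exists>g\<in>carrier G. \<forall>z\<in>Z. r \<le> word_length G S (inv z \<otimes> g)"
  proof (rule ccontr)
    assume neg: "\<not> ?thesis"
    have "rcosets Z \<subseteq> (\<lambda>h. Z #> h) ` {g \<in> carrier G. word_length G S g \<le> r}"
    proof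
      fix K assume "K \<in> rcosets Z"
      then obtain g where g: "g \<in> carrier G" "K = Z #> g" by (auto simp: RCOSETS_def)
      obtain z where z: "z \<in> Z" "word_length G S (inv z \<otimes> g) < r"
        using neg g(1) by (auto simp: not_le)
      have zG: "inv z \<in> carrier G" "inv z \<in> Z" using z ZG subgroup.m_inv_closed[OF Z] by auto
      have "Z #> (inv z \<otimes> g) = (Z #> inv z) #> g"
        using ZG zG g by (simp add: coset_mult_assoc)
      also have "\<dots> = K" using g subgroup.rcos_const[OF Z is_group zG(2)] by simp
      finally show "K \<in> (\<lambda>h. Z #> h) ` {g \<in> carrier G. word_length G S g \<le> r}"
        using z(2) zG(1) g(1) by (intro image_eqI[of _ _ "inv z \<otimes> g"]) auto
    qed
    then show False using inf finite_word_ball[OF S] finite_surj by blast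
  qed
  then obtain g0 where g0: "g0 \<in> carrier G" "\<And>z. z \<in> Z \<Longrightarrow> r \<le> word_length G S (inv z \<otimes> g0)"
    by blast
  \<comment> \<open>Replace the element by a shortest one of its coset.\<close>
  define z0 where "z0 = (ARG_MIN (\<lambda>z. word_length G S (inv z \<otimes> g0)) z. z \<in> Z)"
  have z0: "z0 \<in> Z" and min: "\<And>z. z \<in> Z \<Longrightarrow> word_length G S (inv z0 \<otimes> g0) \<le> word_length G S (inv z \<otimes> g0)"
    using arg_min_nat_lemma[of "\<lambda>z. z \<in> Z" "\<one>" "\<lambda>z. word_length G S (inv z \<otimes> g0)"]
      subgroup.one_closed[OF Z] unfolding z0_def by auto
  have z0G: "z0 \<in> carrier G" using z0 ZG by blast
  define g where "g = inv z0 \<otimes> g0"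
  have g: "g \<in> carrier G" using z0G g0 by (simp add: g_def)
  have g_min: "word_length G S g \<le> word_length G S (inv z \<otimes> g)" if z: "z \<in> Z" for z
  proof -
    have zG: "z \<in> carrier G" using z ZG by blast
    have "inv z \<otimes> g = inv (z0 \<otimes> z) \<otimes> g0"
      using z0G zG g0(1) by (simp add: g_def inv_mult_group m_assoc)
    then show ?thesis
      using min[OF subgroup.m_closed[OF Z z0 z]] by (simp add: g_def)
  qed
  obtain ws where ws: "length ws = word_length G S g" "set ws \<subseteq> ?A" "word_prod G ws = g"
    using shortest_word[OF S g] .
  have r: "r \<le> length ws" using g0(2)[OF z0] ws(1) by (simp add: g_def)
  define h u where "h = word_prod G (take r ws)" and "u = word_prod G (drop r ws)"
  have sub: "set (take r ws) \<subseteq> ?A" "set (drop r ws) \<subseteq> ?A"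
    using ws(2) set_take_subset[of r ws] set_drop_subset[of r ws] by blast+
  then have sub': "set (take r ws) \<subseteq> carrier G" "set (drop r ws) \<subseteq> carrier G"
    using letters_in_carrier[OF S] by blast+
  have hu: "h \<in> carrier G" "u \<in> carrier G" "g = h \<otimes> u"
    using word_prod_closed sub' word_prod_append[OF sub'] ws(3) by (auto simp: h_def u_def)
  have hr: "word_length G S h \<le> r" and ur: "word_length G S u \<le> length ws - r"
    using word_length_le[OF sub(1)] word_length_le[OF sub(2)] r by (auto simp: h_def u_def)
  have far: "r \<le> word_length G S (inv z \<otimes> h)" if z: "z \<in> Z" for z
  proof -
    have zG: "z \<in> carrier G" using z ZG by blast
    have "inv z \<otimes> g = (inv z \<otimes> h) \<otimes> u" using hu zG by (simp add: m_assoc)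
    then have "word_length G S g \<le> word_length G S (inv z \<otimes> h) + word_length G S u"
      using g_min[OF z] word_length_mult[OF S, of "inv z \<otimes> h" u] hu zG by simp
    then show ?thesis using ur r ws(1) by linarith
  qed
  have "word_length G S h = r"
    using far[OF subgroup.one_closed[OF Z]] hu hr by simp
  with hu(1) far show thesis using that by blast
qed

end

section \<open>Ultralimits without cut-points\<close>

text \<open>The sets \<open>T i\<close> hold the available translations of the spaces \<open>X i\<close>. The hypothesis on \<open>\<delta>\<close> and
  \<open>\<rho>\<close> says that from every point there is another one, at limiting distance \<open>r\<close>, to which no
  translation in \<open>T i\<close> brings it closer in the limit. That point is the hub required by
  \<open>no_cut_point_if_translations\<close>. Everything is asked at all points, as the ultralimit may be based
  anywhere.\<close>

lemma no_cut_point_ultralimit_if_translations: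
  assumes \<omega>: "nonprincipal_ultrafilter \<omega>" and b: "\<And>i. b i \<in> mspace (X i)"
    and geo: "\<And>i. discretely_geodesic (X i) (c i)" "\<And>i. 0 \<le> c i" "(c \<longlongrightarrow> 0) \<omega>"
    and far: "\<And>i p. p \<in> mspace (X i) \<Longrightarrow> \<exists>y\<in>mspace (X i). mdist (X i) p y = \<delta> i \<and>
        (\<forall>f\<in>T i. \<rho> i \<le> mdist (X i) (f p) y)"
    and far_lim: "(\<delta> \<longlongrightarrow> r) \<omega>" "(\<rho> \<longlongrightarrow> r) \<omega>" "0 < r"
    and T: "\<And>\<epsilon>. 0 < \<epsilon> \<Longrightarrow> \<exists>f g \<eta>. (\<eta> \<longlongrightarrow> \<epsilon>) \<omega> \<and> (\<forall>i. f i \<in> T i \<and> g i \<in> T i \<and>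
        translation (X i) (\<eta> i) (f i) \<and> translation (X i) (\<eta> i) (g i) \<and>
        (\<forall>x\<in>mspace (X i). f i (g i x) = x \<and> g i (f i x) = x))"
  shows "\<not> cut_point (mtopology_of (ultralimit \<omega> X b)) P"
proof (cases "P \<in> mspace (ultralimit \<omega> X b)")
  case False
  then show ?thesis by (simp add: cut_point_def)
next
  case True
  interpret pointed_ultralimit \<omega> X b using \<omega> b by unfold_locales
  obtain p where p: "p \<in> \<S>" "P = pt p" using True by (rule pt_surj)
  have "\<forall>i. \<exists>y\<in>mspace (X i). mdist (X i) (p i) y = \<delta> i \<and> (\<forall>f\<in>T i. \<rho> i \<le> mdist (X i) (f (p i)) y)"
    using far[OF seqs_mspace[OF p(1)]] by blast
  then obtain y where yM: "\<And>i. y i \<in> mspace (X i)" and yd: "\<And>i. mdist (X i) (p i) (y i) = \<delta> i"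
    and yT: "\<And>i f. f \<in> T i \<Longrightarrow> \<rho> i \<le> mdist (X i) (f (p i)) (y i)"
    by metis
  have lim: "((\<lambda>i. mdist (X i) (p i) (y i)) \<longlongrightarrow> r) \<omega>" using far_lim(1) yd by simp
  have y: "y \<in> \<S>" by (rule seqsI[OF p(1) yM lim])
  have yP: "mdist \<L> P (pt y) = r" using pt_dist_eqI[OF p(1) y lim] p(2) by simp
  show ?thesis
  proof (rule no_cut_point_if_translations[OF geodesic_ultralimit[OF geo] True pt_in[OF y]])
    show "pt y \<noteq> P" using yP far_lim(3) mdist_refl[OF True] by auto
    fix \<epsilon> :: real assume "0 < \<epsilon>"
    from T[OF this] obtain f g \<eta> where \<eta>: "(\<eta> \<longlongrightarrow> \<epsilon>) \<omega>"
      and fT: "\<And>i. f i \<in> T i" and gT: "\<And>i. g i \<in> T i"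
      and f: "\<And>i. translation (X i) (\<eta> i) (f i)" and g: "\<And>i. translation (X i) (\<eta> i) (g i)"
      and fg: "\<And>i x. x \<in> mspace (X i) \<Longrightarrow> f i (g i x) = x"
      and gf: "\<And>i x. x \<in> mspace (X i) \<Longrightarrow> g i (f i x) = x"
      by blast
    obtain F where F: "translation \<L> \<epsilon> F" "\<And>x. x \<in> \<S> \<Longrightarrow> (\<lambda>i. f i (x i)) \<in> \<S>"
      "\<And>x. x \<in> \<S> \<Longrightarrow> F (pt x) = pt (\<lambda>i. f i (x i))"
      using translation_ultralimit[OF f \<eta>] by blast
    obtain H where H: "translation \<L> \<epsilon> H" "\<And>x. x \<in> \<S> \<Longrightarrow> (\<lambda>i. g i (x i)) \<in> \<S>"
      "\<And>x. x \<in> \<S> \<Longrightarrow> H (pt x) = pt (\<lambda>i. g i (x i))"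
      using translation_ultralimit[OF g \<eta>] by blast
    have inverse: "F (H P) = P" "H (F P) = P"
      using F(2,3) H(2,3) p fg gf seqs_mspace[OF p(1)] by simp_all
    have farL: "r \<le> mdist \<L> (pt q) (pt y)"
      if q: "q \<in> \<S>" "\<And>i. \<rho> i \<le> mdist (X i) (q i) (y i)" for q
      by (rule tendsto_le[OF nontrivial pt_dist_tendsto[OF q(1) y] far_lim(2)]) (use q(2) in simp)
    have "r \<le> mdist \<L> (F P) (pt y)" "r \<le> mdist \<L> (H P) (pt y)"
      using farL[OF F(2)[OF p(1)] yT[OF fT]] farL[OF H(2)[OF p(1)] yT[OF gT]]
        F(3)[OF p(1)] H(3)[OF p(1)] p(2) by simp_all
    then show "\<exists>f g. translation \<L> \<epsilon> f \<and> translation \<L> \<epsilon> g \<and> f (g P) = P \<and> g (f P) = P \<and>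
        mdist \<L> (pt y) P \<le> mdist \<L> (pt y) (f P) \<and> mdist \<L> (pt y) P \<le> mdist \<L> (pt y) (g P)"
      using F(1) H(1) inverse yP by (intro exI[of _ F] exI[of _ H]) (simp add: mdist_sym)
  qed
qed

theorem theorem6p7:
  shows "uniformly_unconstricted
           {word_metric G S | (G :: 'a monoid) S. G \<in> family_G \<and> finite_generating_set G S}"
  unfolding uniformly_unconstricted_def
proof (intro allI impI)
  fix X :: "nat \<Rightarrow> 'a metric"
  assume "\<forall>n. X n \<in> {word_metric G S | (G :: 'a monoid) S. G \<in> family_G \<and> finite_generating_set G S}"
  then have "\<forall>n. \<exists>(G :: 'a monoid) S. X n = word_metric G S \<and> G \<in> family_G \<and> finite_generating_set G S"
    by simp
  then obtain G :: "nat \<Rightarrow> 'a monoid" and S where X: "\<And>n. X n = word_metric (G n) (S n)"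
    and GF: "\<And>n. G n \<in> family_G" and S: "\<And>n. finite_generating_set (G n) (S n)"
    by metis
  have group: "group (G n)" for n using GF[of n] by (simp add: family_G_def)
  have "\<forall>n. \<exists>Z. central_infinite_cyclic Z (G n)" using GF by (simp add: family_G_def)
  then obtain Z where "\<And>n. central_infinite_cyclic (Z n) (G n)" by metis
  then have Z: "subgroup (Z n) (G n)" "cyclic_group (G n\<lparr>carrier := Z n\<rparr>)" "infinite (Z n)"
    and central: "\<And>z g. z \<in> Z n \<Longrightarrow> g \<in> carrier (G n) \<Longrightarrow> z \<otimes>\<^bsub>G n\<^esub> g = g \<otimes>\<^bsub>G n\<^esub> z" for n
    unfolding central_infinite_cyclic_def by blast+
  have index: "infinite (rcosets\<^bsub>G n\<^esub> (Z n))" for n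
    using GF[of n] Z(1,2)[of n] by (auto simp: family_G_def virtually_cyclic_def)
  have ZG: "z \<in> carrier (G n)" if "z \<in> Z n" for n z
    using subgroup.subset[OF Z(1)] that by blast
  let ?wl = "\<lambda>n. word_length (G n) (S n)"
  have "\<exists>C. \<forall>r. \<exists>z\<in>Z n. r \<le> ?wl n z \<and> ?wl n z \<le> r + C" for n
    using group.cyclic_subgroup_lengths[OF group S Z] by blast
  then obtain C where C: "\<And>n r. \<exists>z\<in>Z n. r \<le> ?wl n z \<and> ?wl n z \<le> r + C n"
    by metis
  \<comment> \<open>The scale outgrows both n and the gaps C n between the lengths of central elements.\<close>
  define d :: "nat \<Rightarrow> real" where "d n = real (Suc n) * real (Suc (C n))" for n
  have d_pos: "0 < d n" for n by (simp add: d_def)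
  have d_ge: "real n \<le> d n" for n
    by (simp add: d_def algebra_simps)
  have C_d: "real (Suc (C n)) / d n = inverse (real (Suc n))" for n
    by (simp add: d_def inverse_eq_divide del: of_nat_Suc)
  obtain \<omega> :: "nat filter" where \<omega>: "nonprincipal_ultrafilter \<omega>" "\<omega> \<le> sequentially"
    using exists_nonprincipal_ultrafilter by blast
  have d_top: "filterlim d at_top \<omega>"
    by (rule filterlim_mono[OF filterlim_at_top_mono[OF filterlim_real_sequentially] order_refl \<omega>(2)])
      (simp add: d_ge)
  have small: "((\<lambda>n. inverse (real (Suc n))) \<longlongrightarrow> 0) \<omega>"
    by (rule tendsto_mono[OF \<omega>(2) LIMSEQ_inverse_real_of_nat])
  \<comment> \<open>Lengths that meet a target e * d n up to rounding and a gap C n rescale to e in the limit.\<close>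
  have approx: "((\<lambda>n. 1 / d n * real (q n)) \<longlongrightarrow> e) \<omega>"
    if "\<And>n. nat \<lceil>e * d n\<rceil> \<le> q n" "\<And>n. q n \<le> nat \<lceil>e * d n\<rceil> + C n" "0 \<le> e" for q :: "nat \<Rightarrow> nat" and e
  proof (rule tendsto_sandwich[OF _ _ tendsto_const])
    show "((\<lambda>n. e + inverse (real (Suc n))) \<longlongrightarrow> e) \<omega>"
      using tendsto_add[OF tendsto_const small, of e] by simp
    have "e \<le> 1 / d n * real (q n) \<and> 1 / d n * real (q n) \<le> e + inverse (real (Suc n))" for n
    proof -
      have nn: "0 \<le> e * d n" using that(3) d_pos[of n] by simp
      have "e * d n \<le> real (q n)" using that(1)[of n] nn by linarith
      moreover have "real (q n) \<le> e * d n + real (Suc (C n))" using that(2)[of n] nn by linarith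
      ultimately show ?thesis
        unfolding C_d[symmetric] using d_pos[of n] by (simp add: field_simps)
    qed
    then show "\<forall>\<^sub>F n in \<omega>. e \<le> 1 / d n * real (q n)"
      "\<forall>\<^sub>F n in \<omega>. 1 / d n * real (q n) \<le> e + inverse (real (Suc n))" by simp_all
  qed
  have c_lim: "((\<lambda>n. 1 / d n) \<longlongrightarrow> 0) \<omega>"
    using tendsto_inverse_0_at_top[OF d_top] by (simp add: inverse_eq_divide)
  have c_pos: "0 < 1 / d n" for n using d_pos by simp
  let ?Y = "\<lambda>n. rescale (1 / d n) (X n)"
  have Y: "mspace (?Y n) = carrier (G n)"
    "mdist (?Y n) = (\<lambda>x y. 1 / d n * word_dist (G n) (S n) x y)" for n
    by (simp_all only: X rescale_simps[OF c_pos] group.word_metric_simps[OF group S])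
  show "\<exists>(\<omega> :: nat filter) (d :: nat \<Rightarrow> real).
           nonprincipal_ultrafilter \<omega> \<and> (\<forall>n. 0 < d n) \<and> filterlim d at_top \<omega> \<and>
           (\<forall>b. (\<forall>n. b n \<in> mspace (X n)) \<longrightarrow>
              (\<nexists>p. cut_point (mtopology_of (ultralimit \<omega> (\<lambda>n. rescale (1 / d n) (X n)) b)) p))"
  proof (intro exI[of _ \<omega>] exI[of _ d] conjI allI impI notI)
    show "nonprincipal_ultrafilter \<omega>" "filterlim d at_top \<omega>" "0 < d n" for n
      using \<omega> d_top d_pos by simp_all
    fix b assume b: "\<forall>n. b n \<in> mspace (X n)"
    assume "\<exists>p. cut_point (mtopology_of (ultralimit \<omega> ?Y b)) p"
    then obtain P where P: "cut_point (mtopology_of (ultralimit \<omega> ?Y b)) P" by blast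
    \<comment> \<open>The translations are the right multiplications by central elements; the hub of p is p times an element at distance about d n from the central subgroup.\<close>
    have "\<not> cut_point (mtopology_of (ultralimit \<omega> ?Y b)) P"
    proof (rule no_cut_point_ultralimit_if_translations[OF \<omega>(1)])
      let ?T = "\<lambda>n. (\<lambda>z g. g \<otimes>\<^bsub>G n\<^esub> z) ` Z n" and ?r = "\<lambda>n. nat \<lceil>1 * d n\<rceil>"
      show "b n \<in> mspace (?Y n)" for n
        using b c_pos by (simp only: rescale_simps)
      show "discretely_geodesic (?Y n) (1 / d n)" for n
        unfolding X by (rule group.word_metric_discretely_geodesic[OF group S c_pos])
      show "0 \<le> 1 / d n" for n using c_pos[of n] by simp
      show "((\<lambda>n. 1 / d n) \<longlongrightarrow> 0) \<omega>" by (rule c_lim)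
      show "((\<lambda>n. 1 / d n * real (?r n)) \<longlongrightarrow> 1) \<omega>" "((\<lambda>n. 1 / d n * real (?r n)) \<longlongrightarrow> 1) \<omega>"
        by (rule approx; simp)+
      show "(0::real) < 1" by simp
      show "\<exists>y\<in>mspace (?Y n). mdist (?Y n) p y = 1 / d n * real (?r n) \<and>
          (\<forall>f\<in>?T n. 1 / d n * real (?r n) \<le> mdist (?Y n) (f p) y)" if p: "p \<in> mspace (?Y n)" for n p
      proof -
        interpret group "G n" by (rule group)
        have pG: "p \<in> carrier (G n)" using p by (simp only: Y)
        obtain g where g: "g \<in> carrier (G n)" "?wl n g = ?r n"
          and far: "\<And>z. z \<in> Z n \<Longrightarrow> ?r n \<le> ?wl n (inv\<^bsub>G n\<^esub> z \<otimes>\<^bsub>G n\<^esub> g)"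
          using far_from_infinite_index_subgroup[OF S Z(1) index, where r = "?r n"] by blast
        have 1: "inv\<^bsub>G n\<^esub> p \<otimes>\<^bsub>G n\<^esub> (p \<otimes>\<^bsub>G n\<^esub> g) = g" using pG g(1) by (simp flip: m_assoc)
        have 2: "inv\<^bsub>G n\<^esub> (p \<otimes>\<^bsub>G n\<^esub> z) \<otimes>\<^bsub>G n\<^esub> (p \<otimes>\<^bsub>G n\<^esub> g) = inv\<^bsub>G n\<^esub> z \<otimes>\<^bsub>G n\<^esub> g"
          if "z \<in> Z n" for z
          using pG g(1) ZG[OF that] 1 by (simp add: inv_mult_group m_assoc)
        show ?thesis
          unfolding Y
        proof (intro bexI[of _ "p \<otimes>\<^bsub>G n\<^esub> g"] conjI ballI)
          show "1 / d n * word_dist (G n) (S n) p (p \<otimes>\<^bsub>G n\<^esub> g) = 1 / d n * real (?r n)"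
            using pG g 1 by (simp add: word_dist_def)
          fix f assume "f \<in> ?T n"
          then obtain z where z: "z \<in> Z n" "f = (\<lambda>g. g \<otimes>\<^bsub>G n\<^esub> z)" by blast
          have "word_dist (G n) (S n) (f p) (p \<otimes>\<^bsub>G n\<^esub> g) = ?wl n (inv\<^bsub>G n\<^esub> z \<otimes>\<^bsub>G n\<^esub> g)"
            using pG g(1) ZG[OF z(1)] 2[OF z(1)] z(2) by (simp add: word_dist_def)
          then show "1 / d n * real (?r n) \<le> 1 / d n * word_dist (G n) (S n) (f p) (p \<otimes>\<^bsub>G n\<^esub> g)"
            using far[OF z(1)] c_pos[of n] by (simp only: of_nat_le_iff mult_left_mono less_imp_le)
        qed (use pG g in simp)
      qed
      fix \<epsilon> :: real assume \<epsilon>: "0 < \<epsilon>"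
      have "\<forall>n. \<exists>z. z \<in> Z n \<and> nat \<lceil>\<epsilon> * d n\<rceil> \<le> ?wl n z \<and> ?wl n z \<le> nat \<lceil>\<epsilon> * d n\<rceil> + C n"
        using C by blast
      then obtain z where z: "\<And>n. z n \<in> Z n" "\<And>n. nat \<lceil>\<epsilon> * d n\<rceil> \<le> ?wl n (z n)"
        "\<And>n. ?wl n (z n) \<le> nat \<lceil>\<epsilon> * d n\<rceil> + C n"
        by (auto dest!: choice)
      define z' where "z' n = inv\<^bsub>G n\<^esub> (z n)" for n
      have z': "z' n \<in> Z n" "?wl n (z' n) = ?wl n (z n)" for n
        using subgroup.m_inv_closed[OF Z(1) z(1)] group.word_length_inv[OF group S ZG[OF z(1)]]
        by (simp_all add: z'_def)
      have tr: "translation (?Y n) (1 / d n * real (?wl n x)) (\<lambda>g. g \<otimes>\<^bsub>G n\<^esub> x)" if "x \<in> Z n" for n x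
        unfolding X by (rule group.central_translation[OF group S c_pos ZG[OF that] central[OF that]])
      have cancel: "g \<otimes>\<^bsub>G n\<^esub> z' n \<otimes>\<^bsub>G n\<^esub> z n = g" "g \<otimes>\<^bsub>G n\<^esub> z n \<otimes>\<^bsub>G n\<^esub> z' n = g"
        if "g \<in> carrier (G n)" for g n
      proof -
        interpret group "G n" by (rule group)
        show "g \<otimes>\<^bsub>G n\<^esub> z' n \<otimes>\<^bsub>G n\<^esub> z n = g" "g \<otimes>\<^bsub>G n\<^esub> z n \<otimes>\<^bsub>G n\<^esub> z' n = g"
          using that ZG[OF z(1)] by (simp_all add: z'_def m_assoc)
      qed
      show "\<exists>f g \<eta>. (\<eta> \<longlongrightarrow> \<epsilon>) \<omega> \<and> (\<forall>n. f n \<in> ?T n \<and> g n \<in> ?T n \<and>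
          translation (?Y n) (\<eta> n) (f n) \<and> translation (?Y n) (\<eta> n) (g n) \<and>
          (\<forall>x\<in>mspace (?Y n). f n (g n x) = x \<and> g n (f n x) = x))"
      proof (intro exI conjI allI ballI)
        show "((\<lambda>n. 1 / d n * real (?wl n (z n))) \<longlongrightarrow> \<epsilon>) \<omega>"
          using z(2,3) \<epsilon> by (intro approx) auto
        show "(\<lambda>g. g \<otimes>\<^bsub>G n\<^esub> z n) \<in> ?T n" "(\<lambda>g. g \<otimes>\<^bsub>G n\<^esub> z' n) \<in> ?T n" for n
          using z(1) z'(1) by auto
        show "translation (?Y n) (1 / d n * real (?wl n (z n))) (\<lambda>g. g \<otimes>\<^bsub>G n\<^esub> z n)"
          "translation (?Y n) (1 / d n * real (?wl n (z n))) (\<lambda>g. g \<otimes>\<^bsub>G n\<^esub> z' n)" for n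
          using tr[OF z(1)] tr[OF z'(1)] z'(2) by simp_all
        show "x \<otimes>\<^bsub>G n\<^esub> z' n \<otimes>\<^bsub>G n\<^esub> z n = x" "x \<otimes>\<^bsub>G n\<^esub> z n \<otimes>\<^bsub>G n\<^esub> z' n = x"
          if "x \<in> mspace (?Y n)" for n x
          using cancel that unfolding Y by blast+
      qed
    qed
    with P show False by blast
  qed
qed

end
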